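(* Let $G_1,G_2$ be finite abelian groups, let $S_i\subseteq G_i\setminus\{0\}$ satisfy $S_i=-S_i$ for $i=1,2$, put $G=G_1\times G_2$ and $S=(S_1\times\{0\})\cup(\{0\}\times S_2)$, and let $K$ be a field with $\operatorname{char}(K)\nmid |G|$. Then there is an injective $K$-algebra homomorphism $$\iota:\mathcal{A}_K(\mathrm{Cay}(G,S))\hookrightarrow\mathcal{A}_K(\mathrm{Cay}(G_1,S_1))\otimes_K\mathcal{A}_K(\mathrm{Cay}(G_2,S_2)).$$ In particular, writing $d_i=\dim_K\mathcal{A}_K(\mathrm{Cay}(G_i,S_i))$, $$\dim_K\mathcal{A}_K(\mathrm{Cay}(G,S))\le d_1d_2,$$ with equality if and only if the sums $\lambda^{(1)}+\lambda^{(2)}\in\overline{K}$, where $\lambda^{(1)}$ ranges over the distinct eigenvalues of $A_1$ in $\overline{K}$ and $\lambda^{(2)}$ over the distinct eigenvalues of $A_2$ in $\overline{K}$, are pairwise distinct for distinct pairs $(\lambda^{(1)},\lambda^{(2)})$.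
   Context: Groups are written additively. For a finite abelian group $H$ and $T\subseteq H\setminus\{0\}$ with $T=-T$, $\mathrm{Cay}(H,T)$ is the graph with vertex set $H$ and edges $\{g,g+t\}$ for $g\in H$, $t\in T$. Its adjacency matrix, with rows and columns indexed by $H$, has $(g,h)$ entry $1$ if $h-g\in T$ and $0$ otherwise, regarded as a matrix over $K$. The spectral algebra $\mathcal{A}_K(\mathrm{Cay}(H,T))$ is the $K$-algebra of polynomials in this adjacency matrix, inside $M_{|H|}(K)$. $A_i$ denotes the adjacency matrix of $\mathrm{Cay}(G_i,S_i)$, and $\overline{K}$ is an algebraic closure of $K$. *)

theory Defs
  imports
    "HOL-Analysis.Finite_Cartesian_Product"
    "HOL-Algebra.Algebraic_Closure_Type"
    "HOL-Algebra.Module"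
    "HOL-Algebra.QuotRing"
    "HOL-Library.Poly_Mapping"
    "HOL-Library.Product_Plus"
begin

section \<open>Cayley graphs and adjacency matrices\<close>

text \<open>
  Finite groups are types of class \<^class>\<open>finite\<close> and \<^class>\<open>ab_group_add\<close>; a graph is given by its
  edge set, the vertex set being the whole type.
\<close>

definition Cay :: "'g::ab_group_add set \<Rightarrow> 'g set set" where
  "Cay T = {{g, g + t} | g t. t \<in> T}"

definition adjacency_matrix :: "'k::field itself \<Rightarrow> 'v::finite set set \<Rightarrow> 'k ^ 'v ^ 'v" where
  "adjacency_matrix _ E = (\<chi> g h. if {g, h} \<in> E then 1 else 0)"

lemma adjacency_matrix_Cay:
  fixes T :: "'g::{finite, ab_group_add} set"
  assumes "uminus ` T = T"
  shows "adjacency_matrix TYPE('k::field) (Cay T) $ g $ h = (if h - g \<in> T then 1 else 0)"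
proof -
  have "g - h \<in> T \<Longrightarrow> h - g \<in> T"
    using assms by (metis image_eqI minus_diff_eq)
  hence "{g, h} \<in> Cay T \<longleftrightarrow> h - g \<in> T"
  proof -
    assume sym: "g - h \<in> T \<Longrightarrow> h - g \<in> T"
    have "h - g \<in> T \<Longrightarrow> \<exists>a t. {g, h} = {a, a + t} \<and> t \<in> T"
      by (rule exI[of _ g], rule exI[of _ "h - g"]) auto
    thus ?thesis using sym by (auto simp: Cay_def doubleton_eq_iff)
  qed
  thus ?thesis by (simp add: adjacency_matrix_def)
qed

definition eigenvalues :: "'a::field ^ 'n::finite ^ 'n \<Rightarrow> 'a set" where
  "eigenvalues A = {l. \<exists>v. v \<noteq> 0 \<and> A *v v = l *s v}"


section \<open>The spectral algebra\<close>

text \<open>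
  Algebras over a field \<open>'k\<close> are records of type \<open>('k, _) module\<close>; the base ring for the locale
  \<^locale>\<open>algebra\<close> is \<^const>\<open>ring_of_type_algebra\<close>. On matrices, the type class product \<open>(*)\<close> is
  not the matrix product and \<open>(*s)\<close> does not scale by an element of \<open>'k\<close>.
\<close>

definition matrix_scale :: "'k::field \<Rightarrow> 'k ^ 'n ^ 'm \<Rightarrow> 'k ^ 'n ^ 'm" where
  "matrix_scale c A = (\<chi> i j. c * A $ i $ j)"

lemma vector_space_matrix_scale: "vector_space matrix_scale"
  by unfold_locales (auto simp: matrix_scale_def vec_eq_iff algebra_simps)

definition matrix_algebra :: "('k::field, 'k ^ 'n::finite ^ 'n) module" where
  "matrix_algebra = \<lparr>carrier = UNIV, monoid.mult = (**), one = mat 1,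
     ring.zero = 0, add = (+), module.smult = matrix_scale\<rparr>"

definition matrix_poly :: "'k::field poly \<Rightarrow> 'k ^ 'n::finite ^ 'n \<Rightarrow> 'k ^ 'n ^ 'n" where
  "matrix_poly p A = (\<Sum>i\<le>degree p. matrix_scale (coeff p i) (A [^]\<^bsub>matrix_algebra\<^esub> i))"

definition spectral_algebra ::
    "'k::field itself \<Rightarrow> 'v::finite set set \<Rightarrow> ('k, 'k ^ 'v ^ 'v) module" where
  "spectral_algebra K E =
     matrix_algebra\<lparr>carrier := range (\<lambda>p. matrix_poly p (adjacency_matrix K E))\<rparr>"

definition spectral_dim :: "'k::field itself \<Rightarrow> 'v::finite set set \<Rightarrow> nat" where
  "spectral_dim K E = vector_space.dim matrix_scale (carrier (spectral_algebra K E))"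


section \<open>Homomorphisms and tensor products of algebras\<close>

definition algebra_hom :: "('k, 'a) module \<Rightarrow> ('k, 'b) module \<Rightarrow> ('a \<Rightarrow> 'b) set" where
  "algebra_hom M N =
     {h \<in> ring_hom M N. \<forall>c. \<forall>x\<in>carrier M. h (c \<odot>\<^bsub>M\<^esub> x) = c \<odot>\<^bsub>N\<^esub> h x}"

definition pm_scale :: "'k::field \<Rightarrow> ('c \<Rightarrow>\<^sub>0 'k) \<Rightarrow> ('c \<Rightarrow>\<^sub>0 'k)" where
  "pm_scale c f = Poly_Mapping.map ((*) c) f"

lemma lookup_pm_scale [simp]: "Poly_Mapping.lookup (pm_scale c f) k = c * Poly_Mapping.lookup f k"
  unfolding pm_scale_def by transfer (auto simp: when_def)

lemma vector_space_pm_scale: "vector_space pm_scale"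
  by unfold_locales (auto intro!: poly_mapping_eqI simp: lookup_add algebra_simps)

text \<open>
  The vector space with basis \<^term>\<open>carrier M \<times> carrier N\<close>, whose product extends
  \<open>(a, b) \<cdot> (a', b') = (a \<cdot> a', b \<cdot> b')\<close> bilinearly.
\<close>

definition free_mult ::
    "('k::field, 'a) module \<Rightarrow> ('k, 'b) module \<Rightarrow> ('a \<times> 'b \<Rightarrow>\<^sub>0 'k) \<Rightarrow> ('a \<times> 'b \<Rightarrow>\<^sub>0 'k) \<Rightarrow> ('a \<times> 'b \<Rightarrow>\<^sub>0 'k)"
  where
  "free_mult M N f g =
     (\<Sum>p\<in>Poly_Mapping.keys f. \<Sum>q\<in>Poly_Mapping.keys g.
        Poly_Mapping.single (fst p \<otimes>\<^bsub>M\<^esub> fst q, snd p \<otimes>\<^bsub>N\<^esub> snd q)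
          (Poly_Mapping.lookup f p * Poly_Mapping.lookup g q))"

definition free_algebra ::
    "('k::field, 'a) module \<Rightarrow> ('k, 'b) module \<Rightarrow> ('k, 'a \<times> 'b \<Rightarrow>\<^sub>0 'k) module" where
  "free_algebra M N =
     \<lparr>carrier = {f. Poly_Mapping.keys f \<subseteq> carrier M \<times> carrier N},
      monoid.mult = free_mult M N,
      one = Poly_Mapping.single (\<one>\<^bsub>M\<^esub>, \<one>\<^bsub>N\<^esub>) 1,
      ring.zero = 0, add = (+), module.smult = pm_scale\<rparr>"

definition bilinear_relations ::
    "('k::field, 'a) module \<Rightarrow> ('k, 'b) module \<Rightarrow> ('a \<times> 'b \<Rightarrow>\<^sub>0 'k) set" where
  "bilinear_relations M N = Modules.module.span pm_scale (
     (let e = (\<lambda>x y. Poly_Mapping.single (x, y) 1) in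
       {e (x \<oplus>\<^bsub>M\<^esub> x') y - e x y - e x' y | x x' y.
          x \<in> carrier M \<and> x' \<in> carrier M \<and> y \<in> carrier N} \<union>
       {e x (y \<oplus>\<^bsub>N\<^esub> y') - e x y - e x y' | x y y'.
          x \<in> carrier M \<and> y \<in> carrier N \<and> y' \<in> carrier N} \<union>
       {e (c \<odot>\<^bsub>M\<^esub> x) y - pm_scale c (e x y) | c x y. x \<in> carrier M \<and> y \<in> carrier N} \<union>
       {e x (c \<odot>\<^bsub>N\<^esub> y) - pm_scale c (e x y) | c x y. x \<in> carrier M \<and> y \<in> carrier N}))"

text \<open>
  \<^const>\<open>FactRing\<close> only returns a ring record, so the induced scalar multiplication on cosets is
  added as an extra field.
\<close>

definition tensor_product ::
    "('k::field, 'a) module \<Rightarrow> ('k, 'b) module \<Rightarrow> ('k, ('a \<times> 'b \<Rightarrow>\<^sub>0 'k) set) module" where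
  "tensor_product M N =
     (let F = free_algebra M N; R = bilinear_relations M N in
        ring.extend (F Quot R) (module.fields (\<lambda>c U. \<Union>f\<in>U. R +>\<^bsub>F\<^esub> (c \<odot>\<^bsub>F\<^esub> f))))"

end

theory Submission
  imports Defs "HOL-Analysis.Cartesian_Space"
begin

text \<open>
  The adjacency matrix of the product graph is \<open>A = A\<^sub>1 \<otimes> 1 + 1 \<otimes> A\<^sub>2\<close> (Kronecker products). The
  Kronecker product identifies the tensor product of two matrix algebras with an algebra of matrices,
  because a relation among Kronecker products of basis elements must be trivial. As \<open>A\<close> lies in the
  image, the embedding sends a polynomial in \<open>A\<close> to its preimage.

  For the dimensions, translations of \<open>G\<close> have order prime to the characteristic, so over the algebraic
  closure the characters of \<open>G\<close> span all functions. They are eigenvectors of \<open>A\<close>, which is therefore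
  diagonalizable, and the dimension of its spectral algebra is the number of its eigenvalues
  \<open>\<Sum>s\<in>S. \<chi> s\<close>. A character of a product is a product of characters, so the eigenvalues of \<open>A\<close>
  are exactly the sums of an eigenvalue of \<open>A\<^sub>1\<close> and one of \<open>A\<^sub>2\<close>.
\<close>

no_notation fps_nth (infixl \<open>$\<close> 75)

section \<open>Polynomials in a matrix\<close>

lemma matrix_scale_nth [simp]: "matrix_scale c A $ i $ j = c * A $ i $ j"
  by (simp add: matrix_scale_def)

lemma matrix_scale_mult_left: "matrix_scale c A ** B = matrix_scale c (A ** B)"
  by (simp add: vec_eq_iff matrix_matrix_mult_def sum_distrib_left mult.assoc)

lemma matrix_scale_mult_right: "A ** matrix_scale c B = matrix_scale c (A ** B)"
  by (simp add: vec_eq_iff matrix_matrix_mult_def sum_distrib_left mult.left_commute)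

lemma matrix_scale_vector_mult: "matrix_scale c A *v v = c *s (A *v v)"
  by (simp add: vec_eq_iff matrix_vector_mult_def sum_distrib_left mult.assoc)

interpretation ms: vector_space matrix_scale
  by (rule vector_space_matrix_scale)

lemma matrix_add_rdistrib: "(A + B) ** C = A ** C + B ** C"
  by (simp add: vec_eq_iff matrix_matrix_mult_def distrib_right sum.distrib)

lemma sum_matrix_mult: "(\<Sum>i\<in>I. f i) ** B = (\<Sum>i\<in>I. f i ** B)"
  by (induction I rule: infinite_finite_induct) (auto simp: matrix_add_rdistrib)

lemma matrix_mult_sum_right: "B ** (\<Sum>i\<in>I. f i) = (\<Sum>i\<in>I. B ** f i)"
  by (induction I rule: infinite_finite_induct) (auto simp: matrix_add_ldistrib)

lemma matrix_algebra_simps [simp]: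
  "\<one>\<^bsub>matrix_algebra\<^esub> = mat 1"
  "\<zero>\<^bsub>matrix_algebra\<^esub> = 0"
  "A \<otimes>\<^bsub>matrix_algebra\<^esub> B = A ** B"
  "A \<oplus>\<^bsub>matrix_algebra\<^esub> B = A + B"
  "c \<odot>\<^bsub>matrix_algebra\<^esub> A = matrix_scale c A"
  by (simp_all add: matrix_algebra_def)

lemma matrix_pow_commute:
  "A [^]\<^bsub>matrix_algebra\<^esub> (n::nat) ** A = A ** A [^]\<^bsub>matrix_algebra\<^esub> n"
  by (induction n) (simp_all flip: matrix_mul_assoc)

lemma matrix_poly_altdef:
  assumes "degree p \<le> n"
  shows "matrix_poly p A = (\<Sum>i\<le>n. matrix_scale (coeff p i) (A [^]\<^bsub>matrix_algebra\<^esub> i))"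
  unfolding matrix_poly_def
  by (rule sum.mono_neutral_left) (use assms in \<open>auto simp: coeff_eq_0\<close>)

lemma matrix_poly_0 [simp]: "matrix_poly 0 A = 0"
  by (simp add: matrix_poly_def)

text \<open>Horner's rule. It reduces the evaluation laws for sums, multiples and products to
  induction on the polynomial.\<close>

lemma matrix_poly_pCons:
  "matrix_poly (pCons a p) A = matrix_scale a (mat 1) + A ** matrix_poly p A"
proof -
  have "matrix_poly (pCons a p) A
      = (\<Sum>i\<le>Suc (degree p). matrix_scale (coeff (pCons a p) i) (A [^]\<^bsub>matrix_algebra\<^esub> i))"
    by (rule matrix_poly_altdef) (rule degree_pCons_le)
  also have "\<dots> = matrix_scale a (mat 1) + (\<Sum>i\<le>degree p. matrix_scale (coeff p i) (A ** A [^]\<^bsub>matrix_algebra\<^esub> i))"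
    by (subst sum.atMost_Suc_shift) (simp add: matrix_pow_commute)
  finally show ?thesis
    by (simp add: matrix_poly_def matrix_mult_sum_right matrix_scale_mult_right)
qed

lemma matrix_poly_1 [simp]: "matrix_poly 1 A = mat 1"
  by (simp add: one_pCons matrix_poly_pCons)

lemma matrix_poly_X: "matrix_poly [:0, 1:] A = A"
  by (simp add: matrix_poly_pCons)

lemma matrix_poly_add: "matrix_poly (p + q) A = matrix_poly p A + matrix_poly q A"
proof (induction p arbitrary: q)
  case (pCons a p)
  show ?case
    by (cases q) (simp add: matrix_poly_pCons pCons.IH matrix_add_ldistrib ms.scale_left_distrib)
qed simp

lemma matrix_poly_smult: "matrix_poly (smult c p) A = matrix_scale c (matrix_poly p A)"
  by (induction p)
    (simp_all add: matrix_poly_pCons ms.scale_right_distrib matrix_scale_mult_right)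

lemma matrix_poly_diff: "matrix_poly (p - q) A = matrix_poly p A - matrix_poly q A"
  using matrix_poly_add[of "p - q" q A] by (simp add: algebra_simps)

lemma matrix_poly_mult: "matrix_poly (p * q) A = matrix_poly p A ** matrix_poly q A"
  by (induction p)
    (simp_all add: matrix_poly_pCons matrix_poly_add matrix_poly_smult matrix_add_rdistrib
      matrix_scale_mult_left matrix_mul_assoc)

lemma matrix_poly_sum: "matrix_poly (\<Sum>i\<in>I. f i) A = (\<Sum>i\<in>I. matrix_poly (f i) A)"
  by (induction I rule: infinite_finite_induct) (auto simp: matrix_poly_add)

lemma matrix_poly_monom_1: "matrix_poly (monom 1 n) A = A [^]\<^bsub>matrix_algebra\<^esub> n"
  by (induction n) (simp_all add: monom_Suc matrix_poly_pCons matrix_pow_commute)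

section \<open>Eigenvectors and change of field\<close>

text \<open>Applied to an annihilating polynomial, this forces every eigenvalue to be one of its
  roots.\<close>

lemma matrix_poly_eigenvector:
  assumes "A *v v = l *s v"
  shows "matrix_poly p A *v v = poly p l *s v"
proof (induction p)
  case (pCons a p)
  have "matrix_poly (pCons a p) A *v v = a *s v + A *v (poly p l *s v)"
    by (simp add: matrix_poly_pCons matrix_vector_mult_add_rdistrib matrix_scale_vector_mult
        pCons.IH flip: matrix_vector_mul_assoc)
  also have "A *v (poly p l *s v) = (l * poly p l) *s v"
    by (simp add: vector_scalar_commute assms vector_smult_assoc mult.commute)
  finally show ?case
    by (simp add: vec.scale_left_distrib)
qed simp

lemma map_matrix_to_ac_poly:
  fixes A :: "'k::field ^ 'n::finite ^ 'n"
  shows "map_matrix to_ac (matrix_poly p A) = matrix_poly (map_poly to_ac p) (map_matrix to_ac A)"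
proof (induction p)
  case (pCons a p)
  have "map_matrix to_ac (A ** B) = map_matrix to_ac A ** map_matrix to_ac B" for B :: "'k ^ 'n ^ 'n"
    by (simp add: vec_eq_iff matrix_matrix_mult_def to_ac_sum)
  moreover have "map_matrix to_ac (matrix_scale a (mat 1) + B)
      = matrix_scale (to_ac a) (mat 1) + map_matrix to_ac B" for B :: "'k ^ 'n ^ 'n"
    by (simp add: vec_eq_iff mat_def)
  ultimately show ?case
    using pCons by (simp add: matrix_poly_pCons map_poly_pCons)
qed (simp add: vec_eq_iff)

text \<open>
  A \<open>K\<close>-linear retraction of the embedding of \<open>K\<close> into its algebraic closure, applied to the
  coefficients, turns polynomial relations over the closure into relations over \<open>K\<close>.
\<close>

lemma to_ac_retraction:
  obtains r :: "'k::field alg_closure \<Rightarrow> 'k"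
  where "r 0 = 0" "r 1 = 1" "\<And>x y. r (x + y) = r x + r y" "\<And>c x. r (to_ac c * x) = c * r x"
proof -
  interpret L: vector_space "\<lambda>(c::'k) (x::'k alg_closure). to_ac c * x"
    by unfold_locales (auto simp: algebra_simps)
  interpret P: vector_space_pair "\<lambda>(c::'k) (x::'k alg_closure). to_ac c * x" "(*) :: 'k \<Rightarrow> 'k \<Rightarrow> 'k" ..
  \<comment> \<open>Extending \<open>{1}\<close> to a basis of the closure over \<open>'k\<close>
    gives a linear map with prescribed value at 1.\<close>
  have "L.independent {1}"
    by simp
  then obtain r where r: "Vector_Spaces.linear (\<lambda>c x. to_ac c * x) (*) r" "\<And>x. x \<in> {1} \<Longrightarrow> r x = (1::'k)"
    using P.linear_independent_extend[of "{1}" "\<lambda>_. 1"] by auto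
  interpret r: Vector_Spaces.linear "\<lambda>c x. to_ac c * x" "(*)" r by fact
  show thesis
    by (rule that[of r]) (use r r.add r.scale r.zero in auto)
qed

lemma matrix_poly_descend:
  fixes A :: "'k::field ^ 'n::finite ^ 'n"
    and p :: "'k alg_closure poly"
  assumes "lead_coeff p = 1" "matrix_poly p (map_matrix to_ac A) = 0"
  obtains q :: "'k poly" where "lead_coeff q = 1" "degree q = degree p" "matrix_poly q A = 0"
proof -
  obtain r :: "'k alg_closure \<Rightarrow> 'k"
    where r: "r 0 = 0" "r 1 = 1" "\<And>x y. r (x + y) = r x + r y" "\<And>c x. r (to_ac c * x) = c * r x"
    using to_ac_retraction by metis
  have r_sum: "r (\<Sum>i\<in>I. f i) = (\<Sum>i\<in>I. r (f i))" for f :: "nat \<Rightarrow> _" and I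
    by (induction I rule: infinite_finite_induct) (auto simp: r)
  have pow: "map_matrix to_ac A [^]\<^bsub>matrix_algebra\<^esub> i = map_matrix to_ac (A [^]\<^bsub>matrix_algebra\<^esub> i)" for i :: nat
    using map_matrix_to_ac_poly[of "monom 1 i" A] by (simp add: map_poly_monom matrix_poly_monom_1)
  define q where "q = map_poly r p"
  \<comment> \<open>The retraction fixes 1, so a monic polynomial stays monic of the same
    degree.\<close>
  have "lead_coeff p = 1" using assms by simp
  then have "coeff q (degree p) = 1"
    by (simp add: q_def coeff_map_poly r)
  moreover have "degree q \<le> degree p"
    unfolding q_def by (rule degree_le) (simp add: coeff_map_poly coeff_eq_0 r)
  ultimately have deg: "degree q = degree p"
    by (metis le_antisym le_degree one_neq_zero)
  have "matrix_poly q A $ i $ j = r (matrix_poly p (map_matrix to_ac A) $ i $ j)" for i j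
    by (simp add: matrix_poly_def deg pow sum_component r_sum mult.commute[of "coeff p _"] r)
      (simp add: mult.commute q_def coeff_map_poly r)
  then have "matrix_poly q A = 0"
    by (simp add: vec_eq_iff assms r)
  with that deg \<open>coeff q (degree p) = 1\<close> show thesis by simp
qed

section \<open>Dimension of the algebra generated by a matrix\<close>

text \<open>The hypotheses make \<open>q\<close> the minimal polynomial of \<open>A\<close>.
  Division by \<open>q\<close> leaves only remainders of smaller degree, and minimality makes the
  powers of \<open>A\<close> below \<open>degree q\<close> independent.\<close>

lemma dim_range_matrix_poly:
  fixes A :: "'k::field ^ 'n::finite ^ 'n"
  assumes monic: "lead_coeff q = 1" and q: "matrix_poly q A = 0"
    and min: "\<And>p. matrix_poly p A = 0 \<Longrightarrow> degree p < degree q \<Longrightarrow> p = 0"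
  shows "ms.dim (range (\<lambda>p. matrix_poly p A)) = degree q"
proof (cases "degree q = 0")
  case True
  \<comment> \<open>This case is contradictory: the identity matrix would be zero, but index types
    are inhabited, so it has a diagonal entry 1.\<close>
  then have "q = 1"
    using monic by (auto elim!: degree_eq_zeroE simp: one_pCons)
  then have "mat 1 = (0 :: 'k ^ 'n ^ 'n)"
    using q by simp
  then have "(mat 1 :: 'k ^ 'n ^ 'n) $ undefined $ undefined = 0"
    by simp
  then show ?thesis
    by (simp add: mat_def)
next
  case False
  define n where "n = degree q"
  define P where "P = (\<lambda>i::nat. A [^]\<^bsub>matrix_algebra\<^esub> i)"
  have indep: "\<forall>i<n. u i = 0" if "(\<Sum>i<n. matrix_scale (u i) (P i)) = 0" for u
  proof -
    define p where "p = (\<Sum>i<n. smult (u i) (monom 1 i))"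
    have "matrix_poly p A = 0"
      using that by (simp add: p_def matrix_poly_sum matrix_poly_smult matrix_poly_monom_1 P_def)
    moreover have "coeff p i = (if i < n then u i else 0)" for i
      by (simp add: p_def coeff_sum coeff_monom if_distrib cong: if_cong)
    then have "degree p < degree q"
      using False unfolding n_def[symmetric]
      by (metis degree_0 gr0I leading_coeff_0_iff)
    ultimately have "p = 0" by (rule min)
    with \<open>\<And>i. coeff p i = (if i < n then u i else 0)\<close> show ?thesis
      by (metis coeff_0)
  qed
  \<comment> \<open>The basis is a set of matrices, so coinciding powers must be excluded before it
    can have \<open>n\<close> elements.\<close>
  have inj: "inj_on P {..<n}"
  proof (rule inj_onI, rule ccontr)
    fix i j assume ij: "i \<in> {..<n}" "j \<in> {..<n}" "P i = P j" "i \<noteq> j"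
    define p :: "'k poly" where "p = monom 1 i - monom 1 j"
    have "matrix_poly p A = 0"
      using ij by (simp add: p_def matrix_poly_diff matrix_poly_monom_1 P_def)
    moreover have "degree p < degree q"
      unfolding p_def using ij by (intro degree_diff_less) (auto simp: degree_monom_eq n_def)
    ultimately have "p = 0" by (rule min)
    then have "coeff p i = 0" by simp
    then show False using ij by (simp add: p_def coeff_monom)
  qed
  show ?thesis
  proof (rule ms.dim_unique[of "P ` {..<n}"])
    show "P ` {..<n} \<subseteq> range (\<lambda>p. matrix_poly p A)"
      by (auto simp: P_def simp flip: matrix_poly_monom_1)
    show "card (P ` {..<n}) = degree q"
      using inj by (simp add: card_image n_def)
    show "ms.independent (P ` {..<n})"
    proof (rule ms.independent_if_scalars_zero)
      fix u x assume "(\<Sum>x\<in>P ` {..<n}. matrix_scale (u x) x) = 0" "x \<in> P ` {..<n}"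
      then show "u x = 0"
        using indep[of "u \<circ> P"] inj by (auto simp: sum.reindex)
    qed simp
    show "range (\<lambda>p. matrix_poly p A) \<subseteq> ms.span (P ` {..<n})"
    proof clarify
      fix p :: "'k poly"
      define s where "s = p mod q"
      have "q \<noteq> 0" using False by auto
      have "matrix_poly p A = matrix_poly (p div q * q + s) A"
        by (simp add: s_def)
      also have "\<dots> = matrix_poly s A"
        by (simp add: matrix_poly_add matrix_poly_mult q)
      also have "\<dots> = (\<Sum>i\<le>degree s. matrix_scale (coeff s i) (P i))"
        by (simp add: matrix_poly_def P_def)
      also have "\<dots> \<in> ms.span (P ` {..<n})"
      proof (intro ms.span_sum ms.span_scale ms.span_base imageI)
        fix i assume "i \<in> {..degree s}"
        moreover have "degree s < n"
          using False \<open>q \<noteq> 0\<close> degree_mod_less[of q p] by (auto simp: s_def n_def)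
        ultimately show "i \<in> {..<n}" by simp
      qed
      finally show "matrix_poly p A \<in> ms.span (P ` {..<n})" .
    qed
  qed
qed


section \<open>Characters and eigenvalues of Cayley graphs\<close>

text \<open>\<open>X^n - 1\<close> splits into linear factors. A repeated root would be a root of
  the derivative \<open>n X^(n-1)\<close>, hence 0 because \<open>n\<close> is nonzero in the field;
  but 0 is not a root of \<open>X^n - 1\<close>.\<close>

lemma card_roots_of_unity_alg_closed:
  assumes n: "of_nat n \<noteq> (0::'l::alg_closed_field)"
  shows "card {z::'l. z ^ n = 1} = n"
proof -
  define p :: "'l poly" where "p = monom 1 n - 1"
  have n0: "n > 0" using n by (cases n) auto
  have deg: "degree p = n"
    unfolding p_def using n0
    by (subst diff_conv_add_uminus, subst degree_add_eq_left) (auto simp: degree_monom_eq)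
  then have p0: "p \<noteq> 0" using n0 by auto
  have "lead_coeff p = 1"
    using n0 by (simp add: deg) (simp add: p_def coeff_eq_0)
  then obtain R where R: "size R = n" "p = (\<Prod>x\<in>#R. [:-x, 1:])"
    using alg_closed_imp_factorization[OF p0] deg by auto
  have root: "poly p z = 0 \<longleftrightarrow> z ^ n = 1" for z
    by (simp add: p_def poly_monom)
  have "set_mset R = {z. poly p z = 0}"
    by (auto simp: R(2) poly_prod_mset prod_mset_zero_iff)
  then have set: "set_mset R = {z. z ^ n = 1}"
    by (simp add: root)
  have "count R z \<le> 1" for z
  proof (rule ccontr)
    assume "\<not> count R z \<le> 1"
    then have "{#z, z#} \<subseteq># R"
      by (auto simp: subseteq_mset_def)
    then obtain R' where R': "R = {#z, z#} + R'"
      by (auto simp: mset_subset_eq_exists_conv)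
    then have "p = [:-z, 1:] * ([:-z, 1:] * (\<Prod>x\<in>#R'. [:-x, 1:]))"
      by (simp add: R)
    then have "poly (pderiv p) z = 0"
      by (simp add: pderiv_mult del: mult_pCons_left)
    then have "of_nat n * z ^ (n - 1) = 0"
      by (simp add: p_def pderiv_diff pderiv_monom poly_monom)
    then have "z = 0" using n by simp
    moreover have "z ^ n = 1" using set R' by auto
    ultimately show False using n0 by (simp add: power_0_left)
  qed
  then have "R = mset_set (set_mset R)"
    by (intro multiset_eqI) (metis count_eq_zero_iff count_mset_set finite_set_mset le_neq_implies_less less_one)
  then show ?thesis
    using R(1) set by (metis size_mset_set)
qed

text \<open>At most \<open>k < n\<close> elements satisfy \<open>z^k = 1\<close>, so some n-th root
  of unity \<open>w\<close> has \<open>w^k\<close> different from 1. Multiplication by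
  \<open>w\<close> permutes the roots and scales the sum by \<open>w^k\<close>.\<close>

lemma sum_roots_of_unity_power:
  assumes n: "of_nat n \<noteq> (0::'l::alg_closed_field)" and "0 < k" "k < n"
  shows "(\<Sum>z | z ^ n = 1. z ^ k) = (0::'l)"
proof -
  let ?Z = "{z::'l. z ^ n = 1}"
  define p :: "'l poly" where "p = monom 1 k - 1"
  have deg: "degree p = k"
    unfolding p_def using \<open>0 < k\<close>
    by (subst diff_conv_add_uminus, subst degree_add_eq_left) (auto simp: degree_monom_eq)
  then have p0: "p \<noteq> 0" using \<open>0 < k\<close> by auto
  have roots: "{z. poly p z = 0} = {z. z ^ k = 1}"
    by (simp add: p_def poly_monom)
  have "finite {z::'l. z ^ k = 1}" "card {z::'l. z ^ k = 1} < card ?Z"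
    using poly_roots_finite[OF p0] card_poly_roots_bound[OF p0] \<open>k < n\<close>
    by (simp_all add: roots deg card_roots_of_unity_alg_closed[OF n])
  then have "\<not> ?Z \<subseteq> {z. z ^ k = 1}"
    using card_mono by (metis leD)
  then obtain w :: 'l where w: "w ^ n = 1" "w ^ k \<noteq> 1" by auto
  then have "w \<noteq> 0" using assms by (auto simp: power_0_left split: if_splits)
  have "bij_betw ((*) w) ?Z ?Z"
    by (rule bij_betw_byWitness[where f' = "\<lambda>z. z / w"])
      (use w \<open>w \<noteq> 0\<close> in \<open>auto simp: power_mult_distrib power_divide\<close>)
  then have "(\<Sum>z\<in>?Z. z ^ k) = (\<Sum>z\<in>?Z. (w * z) ^ k)"
    by (rule sum.reindex_bij_betw[symmetric])
  also have "\<dots> = w ^ k * (\<Sum>z\<in>?Z. z ^ k)"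
    by (simp add: power_mult_distrib sum_distrib_left)
  finally show ?thesis using w by simp
qed

section \<open>Translations and characters of a finite abelian group\<close>

text \<open>Lagrange's theorem, with the multiple of \<open>g\<close> as a repeated sum: comparing
  the sum of all \<open>x\<close> with that of all \<open>x + g\<close> leaves
  \<open>CARD('g)\<close> copies of \<open>g\<close>.\<close>

lemma sum_const_card_group:
  fixes g :: "'g::{finite, ab_group_add}"
  shows "(\<Sum>i<CARD('g). g) = 0"
proof -
  have "(\<Sum>x\<in>UNIV. x) = (\<Sum>x\<in>UNIV. x + g)"
    by (rule sum.reindex_bij_witness[of _ "\<lambda>x. x + g" "\<lambda>x. x - g"]) auto
  then have "(\<Sum>x\<in>(UNIV :: 'g set). g) = 0"
    by (simp add: sum.distrib)
  moreover obtain h where "bij_betw h {0..<CARD('g)} (UNIV :: 'g set)"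
    using ex_bij_betw_nat_finite[of "UNIV :: 'g set"] by auto
  ultimately show ?thesis
    using sum.reindex_bij_betw[of h _ _ "\<lambda>_. g"] by (metis lessThan_atLeast0)
qed

text \<open>
  Averaging over the multiples of \<open>g\<close> against the powers of a root of unity \<open>z\<close> projects onto the
  functions that the translation by \<open>g\<close> multiplies by \<open>z\<close>.
\<close>

lemma translation_eigenvector_decomposition:
  fixes w :: "'l::alg_closed_field ^ 'g::{finite, ab_group_add}" and g :: 'g
  assumes n: "of_nat CARD('g) \<noteq> (0::'l)"
  obtains Z and u :: "'l \<Rightarrow> ('l, 'g) vec" where
    "w = (\<Sum>z\<in>Z. u z)" "\<And>z x. z \<in> Z \<Longrightarrow> u z $ (x + g) = z * u z $ x"
    "\<And>z h c. \<forall>x. w $ (x + h) = c * w $ x \<Longrightarrow> \<forall>x. u z $ (x + h) = c * u z $ x"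
proof
  define n where "n = CARD('g)"
  note n' = n[folded n_def]
  \<comment> \<open>\<open>m k\<close> is the multiple k g; the division by \<open>n\<close> in
    \<open>u\<close> makes the components add up to \<open>w\<close>.\<close>
  define m where "m = (\<lambda>k. \<Sum>i<k::nat. g)"
  define u where "u = (\<lambda>z. (\<chi> x. (\<Sum>k<n. z ^ k * w $ (x - m k)) / of_nat n))"
  let ?Z = "{z::'l. z ^ n = 1}"
  have m0: "m 0 = 0" "m n = 0"
    using sum_const_card_group[of g] by (simp_all add: m_def n_def)
  have mS: "m (Suc k) = m k + g" for k by (simp add: m_def)
  show "w = (\<Sum>z\<in>?Z. u z)"
  proof -
    have "(\<Sum>z\<in>?Z. u z) $ x = w $ x" for x
    proof -
      have n0: "n > 0" by (simp add: n_def)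
      have "(\<Sum>z\<in>?Z. u z) $ x = (\<Sum>k<n. (\<Sum>z\<in>?Z. z ^ k) * w $ (x - m k)) / of_nat n"
        unfolding sum_distrib_right by (subst sum.swap)
          (simp add: u_def sum_component flip: sum_divide_distrib)
      \<comment> \<open>Orthogonality: the sum of \<open>z ^ k\<close> over all n-th roots of unity
        vanishes unless \<open>k = 0\<close>.\<close>
      also have "(\<Sum>k<n. (\<Sum>z\<in>?Z. z ^ k) * w $ (x - m k))
          = (\<Sum>k<n. if k = 0 then of_nat n * w $ x else 0)"
        using sum_roots_of_unity_power[OF n'] card_roots_of_unity_alg_closed[OF n']
        by (intro sum.cong refl) (auto simp: m0)
      also have "\<dots> = of_nat n * w $ x"
        using n0 by simp
      finally show ?thesis using n' by simp
    qed
    then show ?thesis by (simp add: vec_eq_iff)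
  qed
  show "u z $ (x + g) = z * u z $ x" if "z \<in> ?Z" for z x
  proof -
    \<comment> \<open>Multiplying by \<open>z\<close> shifts the summation index by one. The shift
      is cyclic: the terms for 0 and \<open>n\<close> agree, since \<open>z ^ n = 1\<close> and
      \<open>m n = 0\<close>.\<close>
    let ?f = "\<lambda>k. z ^ k * w $ (x + g - m k)"
    have "z * (\<Sum>k<n. z ^ k * w $ (x - m k)) = (\<Sum>k<n. ?f (Suc k))"
      by (simp add: sum_distrib_left mS mult.assoc algebra_simps)
    also have "\<dots> = (\<Sum>k<n. ?f k)"
    proof -
      have "?f 0 + (\<Sum>k<n. ?f (Suc k)) = (\<Sum>k<Suc n. ?f k)"
        by (rule sum.lessThan_Suc_shift[symmetric])
      also have "\<dots> = ?f n + (\<Sum>k<n. ?f k)" by simp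
      also have "?f n = ?f 0" using that by (simp add: m0)
      finally show ?thesis by simp
    qed
    finally show ?thesis by (simp add: u_def)
  qed
  \<comment> \<open>\<open>u z\<close> is a linear combination of translates of \<open>w\<close>,
    and translations commute.\<close>
  show "\<forall>x. u z $ (x + h) = c * u z $ x" if "\<forall>x. w $ (x + h) = c * w $ x" for z h c
  proof
    fix x
    have "w $ (x + h - m k) = c * w $ (x - m k)" for k
      using that by (metis add_diff_eq diff_add_eq)
    then show "u z $ (x + h) = c * u z $ x"
      by (simp add: u_def sum_distrib_left mult.left_commute)
  qed
qed

text \<open>Homomorphisms into the multiplicative group of the field: \<open>c 0 = 1\<close>
  excludes the zero function, and \<open>c g * c (- g) = 1\<close> then makes every value
  nonzero.\<close>

definition characters :: "('g::ab_group_add \<Rightarrow> 'l::field) set" where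
  "characters = {c. c 0 = 1 \<and> (\<forall>g h. c (g + h) = c g * c h)}"

text \<open>Splitting along one group element at a time decomposes every function into simultaneous
  eigenvectors of all translations. Such an eigenvector, if nonzero, is a character times its value
  at 0.\<close>

lemma span_characters:
  assumes n: "of_nat CARD('g::{finite, ab_group_add}) \<noteq> (0::'l::alg_closed_field)"
  shows "vec.span (vec_lambda ` (characters :: ('g \<Rightarrow> 'l) set)) = UNIV"
proof -
  \<comment> \<open>\<open>W T\<close> consists of the functions on which each translation by an
    element of \<open>T\<close> acts as a scalar; for empty \<open>T\<close> these are all
    functions.\<close>
  define W where "W = (\<lambda>T::'g set. {w :: ('l, 'g) vec. \<forall>g\<in>T. \<exists>c. \<forall>x. w $ (x + g) = c * w $ x})"
  have "vec.span (W T) = UNIV" if "finite T" for T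
    using that
  proof (induction T)
    case empty
    then show ?case by (simp add: W_def)
  next
    case (insert g T)
    have "W T \<subseteq> vec.span (W (insert g T))"
    proof
      fix w assume "w \<in> W T"
      obtain Z u where "w = (\<Sum>z\<in>Z. u z)" and Z: "\<And>z x. z \<in> Z \<Longrightarrow> u z $ (x + g) = z * u z $ x"
        and u: "\<And>z h c. \<forall>x. w $ (x + h) = c * w $ x \<Longrightarrow> \<forall>x. u z $ (x + h) = c * u z $ x"
        by (rule translation_eigenvector_decomposition[OF n, of w g]) blast
      have "\<exists>c. \<forall>x. u z $ (x + h) = c * u z $ x" if zh: "z \<in> Z" "h \<in> insert g T" for z h
      proof (cases "h = g")
        case True
        then show ?thesis using Z[OF zh(1)] by (intro exI[of _ z] allI) (simp only:)
      next
        case False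
        then obtain c where "\<forall>x. w $ (x + h) = c * w $ x"
          using \<open>w \<in> W T\<close> zh(2) by (auto simp: W_def)
        from u[OF this] show ?thesis by (rule exI)
      qed
      then have "u z \<in> W (insert g T)" if "z \<in> Z" for z
        using that by (simp add: W_def)
      then show "w \<in> vec.span (W (insert g T))"
        unfolding \<open>w = _\<close> by (intro vec.span_sum vec.span_base)
    qed
    then have "vec.span (W T) \<subseteq> vec.span (W (insert g T))"
      by (rule vec.span_minimal) (rule vec.subspace_span)
    with insert.IH show ?case by (simp only: top.extremum_unique)
  qed
  then have "vec.span (W UNIV) = UNIV" by simp
  moreover have "W UNIV \<subseteq> vec.span (vec_lambda ` (characters :: ('g \<Rightarrow> 'l) set))"
  proof
    fix w assume w: "w \<in> W UNIV"
    show "w \<in> vec.span (vec_lambda ` characters)"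
    proof (cases "w = 0")
      case False
      obtain c where c: "\<And>g x. w $ (x + g) = c g * w $ x"
      proof -
        have "\<forall>g. \<exists>c. \<forall>x. w $ (x + g) = c * w $ x"
          using w by (simp add: W_def)
        from choice[OF this] show thesis using that by blast
      qed
      have wc: "w $ g = c g * w $ 0" for g
        using c[of 0 g] by simp
      have w0: "w $ 0 \<noteq> 0"
      proof
        assume "w $ 0 = 0"
        then have "w $ g = 0" for g
          by (subst wc) simp
        with False show False
          by (simp add: vec_eq_iff)
      qed
      have "c 0 * w $ 0 = 1 * w $ 0"
        using wc[of 0] by (simp only: mult_1)
      then have "c 0 = 1"
        using w0 by simp
      moreover have "c (g + h) = c g * c h" for g h
      proof -
        have "c (g + h) * w $ 0 = w $ (g + h)"
          by (rule wc[symmetric])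
        also have "\<dots> = c h * (c g * w $ 0)"
          by (simp only: c[of g h] wc[of g])
        also have "\<dots> = (c g * c h) * w $ 0"
          by (simp only: mult_ac)
        finally show ?thesis
          using w0 by simp
      qed
      ultimately have "c \<in> characters" by (simp add: characters_def)
      then have "w $ 0 *s vec_lambda c \<in> vec.span (vec_lambda ` characters)"
        by (intro vec.span_scale vec.span_base imageI)
      moreover have "w $ 0 *s vec_lambda c = w"
        unfolding vec_eq_iff vector_smult_component vec_lambda_beta
        using wc by (metis mult.commute)
      ultimately show ?thesis by (rule back_subst)
    next
      case True
      show ?thesis unfolding True by (rule vec.span_zero)
    qed
  qed
  then have "vec.span (W UNIV) \<subseteq> vec.span (vec_lambda ` (characters :: ('g \<Rightarrow> 'l) set))"
    by (rule vec.span_minimal) (rule vec.subspace_span)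
  ultimately show ?thesis by (metis top.extremum_unique)
qed

section \<open>Eigenvalues of a Cayley graph\<close>

text \<open>The neighbours of \<open>g\<close> are the elements \<open>s + g\<close>, and
  \<open>c (s + g) = c s * c g\<close> lets the factor \<open>c g\<close> be pulled out of the
  sum.\<close>

lemma adjacency_matrix_Cay_character:
  fixes S :: "'g::{finite, ab_group_add} set" and c :: "'g \<Rightarrow> 'l::field"
  assumes "uminus ` S = S" "c \<in> characters"
  shows "adjacency_matrix TYPE('l) (Cay S) *v vec_lambda c = (\<Sum>s\<in>S. c s) *s vec_lambda c"
proof -
  have "(\<Sum>h\<in>UNIV. (if h - g \<in> S then 1 else 0) * c h) = (\<Sum>s\<in>S. c s) * c g" for g
  proof -
    have "(\<Sum>h\<in>UNIV. (if h - g \<in> S then 1 else 0) * c h) = (\<Sum>h | h - g \<in> S. c h)"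
      by (rule sum.mono_neutral_cong_right) simp_all
    also have "\<dots> = (\<Sum>s\<in>S. c (s + g))"
      by (rule sum.reindex_bij_witness[of _ "\<lambda>s. s + g" "\<lambda>h. h - g"]) simp_all
    also have "\<dots> = (\<Sum>s\<in>S. c s * c g)"
      using assms(2) by (intro sum.cong refl) (simp only: characters_def mem_Collect_eq)
    finally show ?thesis
      by (simp only: sum_distrib_right)
  qed
  then show ?thesis
    by (simp add: vec_eq_iff matrix_vector_mult_def adjacency_matrix_Cay[OF assms(1)])
qed

text \<open>A basis \<open>B\<close> chosen from \<open>W\<close> is finite even if \<open>W\<close>
  is not. The product of \<open>[:-l, 1:]\<close> over the eigenvalues occurring on \<open>B\<close>
  annihilates \<open>A\<close>, so \<open>A\<close> has no others.\<close>

lemma eigenvalues_of_spanning_eigenvectors: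
  fixes A :: "'l::field ^ 'n::finite ^ 'n"
  assumes span: "vec.span W = UNIV" and nz: "0 \<notin> W"
    and ev: "\<And>w. w \<in> W \<Longrightarrow> A *v w = e w *s w"
  shows "eigenvalues A = e ` W" "finite (eigenvalues A)"
    "matrix_poly (\<Prod>l\<in>eigenvalues A. [:-l, 1:]) A = 0"
proof -
  obtain B where B: "B \<subseteq> W" "vec.independent B" "W \<subseteq> vec.span B"
    by (rule vec.maximal_independent_subset)
  then have fin: "finite B"
    by (simp add: vec.finiteI_independent)
  have spanB: "vec.span B = UNIV"
    using vec.span_minimal[OF B(3) vec.subspace_span] by (simp only: span top.extremum_unique)
  define p where "p = (\<Prod>l\<in>e ` B. [:-l, 1:])"
  have root: "poly p l = 0 \<longleftrightarrow> l \<in> e ` B" for l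
    using fin by (auto simp: p_def poly_prod)
  have "matrix_poly p A *v b = 0" if "b \<in> B" for b
  proof -
    have "matrix_poly p A *v b = poly p (e b) *s b"
      using that B(1) ev by (intro matrix_poly_eigenvector) blast
    also have "poly p (e b) = 0"
      using that by (simp add: root)
    finally show ?thesis by simp
  qed
  then have "B \<subseteq> {v. matrix_poly p A *v v = 0}" by blast
  moreover have "vec.subspace {v. matrix_poly p A *v v = 0}"
    by (rule vec.subspaceI) (simp_all add: matrix_vector_right_distrib vector_scalar_commute)
  ultimately have "vec.span B \<subseteq> {v. matrix_poly p A *v v = 0}"
    by (rule vec.span_minimal)
  then have "matrix_poly p A *v v = 0 *v v" for v
    by (simp add: spanB subset_iff)
  then have p: "matrix_poly p A = 0"
    unfolding matrix_eq by (rule allI)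
  have "eigenvalues A \<subseteq> e ` B"
  proof
    fix l assume "l \<in> eigenvalues A"
    then obtain v where v: "v \<noteq> 0" "A *v v = l *s v"
      by (auto simp: eigenvalues_def)
    then have "poly p l *s v = 0"
      using matrix_poly_eigenvector[of A v l p] p by simp
    with v show "l \<in> e ` B" by (simp add: root)
  qed
  moreover have "e ` W \<subseteq> eigenvalues A"
  proof (rule image_subsetI)
    fix w assume "w \<in> W"
    then have "w \<noteq> 0 \<and> A *v w = e w *s w"
      using ev[of w] nz by (metis (no_types))
    then show "e w \<in> eigenvalues A"
      unfolding eigenvalues_def by (intro CollectI exI)
  qed
  moreover have "e ` B \<subseteq> e ` W"
    using B(1) by (rule image_mono)
  ultimately have *: "eigenvalues A = e ` W" "eigenvalues A = e ` B"
    by (simp_all only: set_eq_subset) (iprover intro: subset_trans)+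
  show "eigenvalues A = e ` W" by fact
  show "finite (eigenvalues A)" "matrix_poly (\<Prod>l\<in>eigenvalues A. [:-l, 1:]) A = 0"
    unfolding *(2) p_def[symmetric] by (rule finite_imageI[OF fin], rule p)
qed

lemma eigenvalues_Cay:
  fixes S :: "'g::{finite, ab_group_add} set"
  assumes S: "uminus ` S = S" and n: "of_nat CARD('g) \<noteq> (0::'l::alg_closed_field)"
  defines "A \<equiv> adjacency_matrix TYPE('l) (Cay S)"
  shows "eigenvalues A = (\<lambda>c. \<Sum>s\<in>S. c s) ` characters" "finite (eigenvalues A)"
    "matrix_poly (\<Prod>l\<in>eigenvalues A. [:-l, 1:]) A = 0"
proof -
  let ?W = "vec_lambda ` characters :: ('l, 'g) vec set"
  have "vec_lambda c $ 0 = 1" if "c \<in> characters" for c :: "'g \<Rightarrow> 'l"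
    using that by (simp add: characters_def)
  then have nz: "0 \<notin> ?W"
    by (metis (no_types, lifting) imageE zero_index zero_neq_one)
  \<comment> \<open>The eigenvalue must be a function of the vector, so the character sum is read
    off from the entries of \<open>w\<close>.\<close>
  have ev: "A *v w = (\<Sum>s\<in>S. w $ s) *s w" if w: "w \<in> ?W" for w
  proof -
    obtain c where "w = vec_lambda c" "c \<in> characters" using w by (rule imageE)
    then show ?thesis
      using adjacency_matrix_Cay_character[OF S, of c] by (simp only: A_def vec_lambda_beta)
  qed
  note * = eigenvalues_of_spanning_eigenvectors[where e = "\<lambda>w. \<Sum>s\<in>S. w $ s" and A = A,
      OF span_characters[OF n] nz, OF ev]
  show "eigenvalues A = (\<lambda>c. \<Sum>s\<in>S. c s) ` characters"
    by (subst *(1)) (auto simp: image_image)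
  show "finite (eigenvalues A)" "matrix_poly (\<Prod>l\<in>eigenvalues A. [:-l, 1:]) A = 0"
    by (rule *; assumption)+
qed

text \<open>The product of \<open>[:-l, 1:]\<close> over the distinct eigenvalues in the closure
  annihilates the matrix and descends to a monic polynomial over \<open>'k\<close> of the same
  degree. A nonzero annihilating polynomial cannot have smaller degree, as all eigenvalues are among
  its roots.\<close>

lemma spectral_dim_eq_card_eigenvalues:
  fixes S :: "'g::{finite, ab_group_add} set"
  assumes S: "uminus ` S = S" and n: "of_nat CARD('g) \<noteq> (0::'k::field)"
  shows "spectral_dim TYPE('k) (Cay S)
    = card (eigenvalues (map_matrix to_ac (adjacency_matrix TYPE('k) (Cay S))))"
proof -
  let ?A = "adjacency_matrix TYPE('k) (Cay S)" and ?L = "adjacency_matrix TYPE('k alg_closure) (Cay S)"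
  have AL: "map_matrix to_ac ?A = ?L"
    by (simp add: vec_eq_iff adjacency_matrix_Cay[OF S])
  have n': "of_nat CARD('g) \<noteq> (0 :: 'k alg_closure)"
    using n by (metis to_ac_eq_0_iff to_ac_of_nat)
  note ev = eigenvalues_Cay[OF S n']
  define p where "p = (\<Prod>l\<in>eigenvalues ?L. [:-l, 1:])"
  have monic: "lead_coeff p = 1"
    unfolding p_def by (simp add: lead_coeff_prod)
  have deg: "degree p = card (eigenvalues ?L)"
    unfolding p_def by (subst degree_prod_eq_sum_degree) auto
  obtain q :: "'k poly" where q: "lead_coeff q = 1" "degree q = degree p" "matrix_poly q ?A = 0"
  proof (rule matrix_poly_descend[of p ?A])
    show "matrix_poly p (map_matrix to_ac ?A) = 0"
      unfolding AL p_def by (rule ev(3))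
  qed (use monic in blast)+
  have "ms.dim (range (\<lambda>p. matrix_poly p ?A)) = degree q"
  proof (rule dim_range_matrix_poly)
    fix r assume r: "matrix_poly r ?A = 0" "degree r < degree q"
    have "matrix_poly (map_poly to_ac r) ?L = 0"
      unfolding AL[symmetric] map_matrix_to_ac_poly[symmetric] r(1) by (simp add: vec_eq_iff)
    have roots: "eigenvalues ?L \<subseteq> {l. poly (map_poly to_ac r) l = 0}"
    proof clarify
      fix l assume "l \<in> eigenvalues ?L"
      then obtain v where v: "v \<noteq> 0" "?L *v v = l *s v"
        by (auto simp: eigenvalues_def)
      show "poly (map_poly to_ac r) l = 0"
        using matrix_poly_eigenvector[OF v(2), of "map_poly to_ac r"] v(1)
        by (simp add: \<open>matrix_poly (map_poly to_ac r) ?L = 0\<close>)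
    qed
    have deg_r: "degree (map_poly to_ac r) = degree r"
      by (rule degree_map_poly) simp
    have "card (eigenvalues ?L) \<le> degree r" if "map_poly to_ac r \<noteq> 0"
    proof -
      have "card (eigenvalues ?L) \<le> card {l. poly (map_poly to_ac r) l = 0}"
        by (rule card_mono[OF poly_roots_finite[OF that] roots])
      also have "\<dots> \<le> degree (map_poly to_ac r)"
        by (rule card_poly_roots_bound[OF that])
      finally show ?thesis by (simp only: deg_r)
    qed
    moreover have "\<not> card (eigenvalues ?L) \<le> degree r"
      using r(2) by (simp only: q(2) deg not_le)
    ultimately have "map_poly to_ac r = 0" by blast
    then show "r = 0"
      by (simp add: map_poly_eq_0_iff)
  qed (use q in auto)
  then show ?thesis
    by (simp add: spectral_dim_def spectral_algebra_def AL q deg)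
qed

section \<open>Connection sets and characters of a product\<close>

lemma uminus_image_product_connection_set:
  assumes "uminus ` S1 = S1" "uminus ` S2 = S2"
  shows "uminus ` (S1 \<times> {0} \<union> {0} \<times> S2) = S1 \<times> {0} \<union> {0 :: 'g::ab_group_add} \<times> (S2 :: 'h::ab_group_add set)"
proof -
  have "- s \<in> S1" if "s \<in> S1" for s
    using assms(1) that by blast
  moreover have "- s \<in> S2" if "s \<in> S2" for s
    using assms(2) that by blast
  ultimately have "- s \<in> S1 \<times> {0} \<union> {0} \<times> S2" if "s \<in> S1 \<times> {0} \<union> {0} \<times> S2" for s
    using that by (cases s) auto
  then have *: "uminus ` (S1 \<times> {0} \<union> {0} \<times> S2) \<subseteq> S1 \<times> {0} \<union> {0} \<times> S2"
    by (rule image_subsetI)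
  show ?thesis
    using image_mono[OF *, of uminus] * by (auto simp: image_image)
qed

text \<open>A character of the product restricts to characters of the two factors, and conversely
  two characters multiply to one of the product. As 0 is not in \<open>S1\<close>, the two parts of
  the connection set are disjoint and the sum splits.\<close>

lemma character_sums_product:
  fixes S1 :: "'g::{finite, ab_group_add} set" and S2 :: "'h::{finite, ab_group_add} set"
  assumes "0 \<notin> S1"
  shows "(\<lambda>c. \<Sum>s\<in>S1 \<times> {0} \<union> {0} \<times> S2. c s) ` (characters :: ('g \<times> 'h \<Rightarrow> 'l::field) set)
    = (\<lambda>(l1, l2). l1 + l2) ` (((\<lambda>c. \<Sum>s\<in>S1. c s) ` characters) \<times> ((\<lambda>c. \<Sum>s\<in>S2. c s) ` characters))"
    (is "?L = ?R")
proof -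
  have split: "(\<Sum>s\<in>S1 \<times> {0} \<union> {0} \<times> S2. c s) = (\<Sum>s\<in>S1. c (s, 0)) + (\<Sum>s\<in>S2. c (0, s))"
    for c :: "'g \<times> 'h \<Rightarrow> 'l"
  proof (subst sum.union_disjoint)
    have "S1 \<times> {0::'h} = (\<lambda>s. (s, 0)) ` S1" "{0::'g} \<times> S2 = Pair 0 ` S2" by auto
    then show "sum c (S1 \<times> {0}) + sum c ({0} \<times> S2) = (\<Sum>s\<in>S1. c (s, 0)) + (\<Sum>s\<in>S2. c (0, s))"
      by (simp add: sum.reindex inj_on_def)
  qed (use assms in auto)
  show ?thesis
  proof
    show "?L \<subseteq> ?R"
    proof clarify
      fix c :: "'g \<times> 'h \<Rightarrow> 'l" assume "c \<in> characters"
      then have c: "c 0 = 1" "c (x + y) = c x * c y" for x y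
        by (simp_all only: characters_def mem_Collect_eq)
      have "(\<lambda>s. c (s, 0)) \<in> characters" "(\<lambda>s. c (0, s)) \<in> characters"
        using c(1) c(2)[of "(_, 0)" "(_, 0)"] c(2)[of "(0, _)" "(0, _)"]
        by (simp_all add: characters_def zero_prod_def)
      then show "sum c (S1 \<times> {0} \<union> {0} \<times> S2) \<in> ?R"
        unfolding split by (intro image_eqI[where x = "(\<Sum>s\<in>S1. c (s, 0), \<Sum>s\<in>S2. c (0, s))"] SigmaI imageI)
          simp_all
    qed
    show "?R \<subseteq> ?L"
    proof clarify
      fix a :: "'g \<Rightarrow> 'l" and b :: "'h \<Rightarrow> 'l" assume ab: "a \<in> characters" "b \<in> characters"
      define c where "c = (\<lambda>(x, y). a x * b y)"
      have "a 0 = 1" "b 0 = 1" and mult: "\<And>x y. a (x + y) = a x * a y" "\<And>x y. b (x + y) = b x * b y"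
        using ab by (simp_all add: characters_def)
      then have "c 0 = 1"
        by (simp add: c_def zero_prod_def)
      moreover have "c (x + y) = c x * c y" for x y
        by (cases x, cases y) (simp only: c_def add_Pair prod.case mult mult_ac)
      ultimately have "c \<in> characters"
        unfolding characters_def by (intro CollectI conjI allI)
      \<comment> \<open>On each axis the other factor of \<open>c\<close> takes its value at 0,
        which is 1.\<close>
      moreover have "(\<Sum>s\<in>S1 \<times> {0} \<union> {0} \<times> S2. c s) = sum a S1 + sum b S2"
        unfolding split using \<open>a 0 = 1\<close> \<open>b 0 = 1\<close> by (simp add: c_def)
      ultimately show "sum a S1 + sum b S2 \<in> ?L"
        by (intro image_eqI[where x = c]) (simp_all only:)
    qed
  qed
qed


section \<open>Kronecker products and tensor products of matrix algebras\<close>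

definition kron :: "'k::field ^ 'a ^ 'a \<Rightarrow> 'k ^ 'b ^ 'b \<Rightarrow> 'k ^ ('a::finite \<times> 'b::finite) ^ ('a \<times> 'b)" where
  "kron A B = (\<chi> p q. A $ fst p $ fst q * B $ snd p $ snd q)"

lemma kron_nth [simp]: "kron A B $ p $ q = A $ fst p $ fst q * B $ snd p $ snd q"
  by (simp add: kron_def)

lemma kron_add_left: "kron (A + A') B = kron A B + kron A' B"
  by (simp add: vec_eq_iff distrib_right)

lemma kron_add_right: "kron A (B + B') = kron A B + kron A B'"
  by (simp add: vec_eq_iff distrib_left)

lemma kron_scale_left: "kron (matrix_scale c A) B = matrix_scale c (kron A B)"
  by (simp add: vec_eq_iff mult_ac)

lemma kron_scale_right: "kron A (matrix_scale c B) = matrix_scale c (kron A B)"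
  by (simp add: vec_eq_iff mult_ac)

lemma kron_one: "kron (mat 1) (mat 1) = mat 1"
  by (simp add: vec_eq_iff mat_def)

text \<open>Mixed-product rule: the sum over pairs of indices factors into two sums.\<close>

lemma kron_mult: "kron A B ** kron C D = kron (A ** C) (B ** D)"
  by (simp add: vec_eq_iff matrix_matrix_mult_def sum_product sum.cartesian_product mult_ac
      split_def flip: UNIV_Times_UNIV)

text \<open>The matrix units form a finite spanning set, which bounds every independent set.\<close>

lemma finite_independent_matrices:
  fixes B :: "('k::field ^ 'n::finite ^ 'm::finite) set"
  assumes "ms.independent B"
  shows "finite B"
proof -
  define u :: "'m \<times> 'n \<Rightarrow> 'k ^ 'n ^ 'm" where "u = (\<lambda>p. \<chi> a b. if p = (a, b) then 1 else 0)"
  have "x \<in> ms.span (range u)" for x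
  proof -
    have "x = (\<Sum>p\<in>UNIV. matrix_scale (x $ fst p $ snd p) (u p))"
      by (simp add: vec_eq_iff sum_component u_def if_distrib cong: if_cong)
    also have "\<dots> \<in> ms.span (range u)"
      by (intro ms.span_sum ms.span_scale ms.span_base rangeI)
    finally show ?thesis .
  qed
  then show ?thesis
    using ms.independent_span_bound[of "range u" B] assms by auto
qed

text \<open>Fixing an entry \<open>(i, k)\<close> of the left factors turns the relation into one
  among \<open>B2\<close>, whose coefficients must vanish. For fixed \<open>c\<close> these are the
  entries of a relation among \<open>B1\<close>.\<close>

lemma kron_independent:
  fixes B1 :: "('k::field ^ 'a::finite ^ 'a) set" and B2 :: "('k ^ 'b::finite ^ 'b) set"
  assumes B1: "ms.independent B1" and B2: "ms.independent B2"
    and zero: "(\<Sum>b\<in>B1. \<Sum>c\<in>B2. matrix_scale (a b c) (kron b c)) = 0"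
    and b: "b \<in> B1" and c: "c \<in> B2"
  shows "a b c = 0"
proof -
  have *: "(\<Sum>b\<in>B1. a b c * b $ i $ k) = 0" if "c \<in> B2" for i k c
  proof -
    have "(\<Sum>c\<in>B2. matrix_scale (\<Sum>b\<in>B1. a b c * b $ i $ k) c) = 0"
      unfolding vec_eq_iff
    proof (intro allI)
      fix j l
      have "(\<Sum>c\<in>B2. matrix_scale (\<Sum>b\<in>B1. a b c * b $ i $ k) c) $ j $ l
          = (\<Sum>b\<in>B1. \<Sum>c\<in>B2. a b c * (b $ i $ k * c $ j $ l))"
        by (subst sum.swap) (simp add: sum_component sum_distrib_right mult.assoc)
      also have "\<dots> = (\<Sum>b\<in>B1. \<Sum>c\<in>B2. matrix_scale (a b c) (kron b c)) $ (i, j) $ (k, l)"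
        by (simp add: sum_component)
      finally show "(\<Sum>c\<in>B2. matrix_scale (\<Sum>b\<in>B1. a b c * b $ i $ k) c) $ j $ l = 0 $ j $ l"
        by (simp add: zero)
    qed
    then show ?thesis
      by (rule ms.independentD[OF B2 finite_independent_matrices[OF B2] order_refl _ that])
  qed
  have "(\<Sum>b\<in>B1. matrix_scale (a b c) b) = 0"
    by (simp add: vec_eq_iff sum_component * c)
  then show ?thesis
    by (rule ms.independentD[OF B1 finite_independent_matrices[OF B1] order_refl _ b])
qed

section \<open>Evaluation of formal sums as matrices\<close>

interpretation pm: vector_space pm_scale
  by (rule vector_space_pm_scale)

text \<open>The linear extension of \<open>kron\<close> to formal sums of pairs, taken on all pairs
  of matrices so that it does not depend on a choice of subspaces.\<close>

definition kron_lift ::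
    "(('k::field ^ 'a ^ 'a) \<times> ('k ^ 'b ^ 'b) \<Rightarrow>\<^sub>0 'k) \<Rightarrow> 'k ^ ('a::finite \<times> 'b::finite) ^ ('a \<times> 'b)" where
  "kron_lift f = (\<Sum>p\<in>Poly_Mapping.keys f. matrix_scale (Poly_Mapping.lookup f p) (kron (fst p) (snd p)))"

lemma kron_lift_superset:
  assumes "finite P" "Poly_Mapping.keys f \<subseteq> P"
  shows "kron_lift f = (\<Sum>p\<in>P. matrix_scale (Poly_Mapping.lookup f p) (kron (fst p) (snd p)))"
  unfolding kron_lift_def
  by (rule sum.mono_neutral_left) (use assms in \<open>auto simp: in_keys_iff\<close>)

lemma kron_lift_0 [simp]: "kron_lift 0 = 0"
  by (simp add: kron_lift_def)

lemma kron_lift_single [simp]: "kron_lift (Poly_Mapping.single (x, y) c) = matrix_scale c (kron x y)"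
  by (simp add: kron_lift_def)

lemma kron_lift_add: "kron_lift (f + g) = kron_lift f + kron_lift g"
proof -
  let ?P = "Poly_Mapping.keys f \<union> Poly_Mapping.keys g"
  have "Poly_Mapping.keys (f + g) \<subseteq> ?P"
    by (rule Poly_Mapping.keys_add)
  then show ?thesis
    by (simp add: kron_lift_superset[of ?P] lookup_add ms.scale_left_distrib sum.distrib)
qed

lemma keys_pm_scale: "Poly_Mapping.keys (pm_scale c f) \<subseteq> Poly_Mapping.keys f"
  by (auto simp: in_keys_iff)

lemma kron_lift_scale: "kron_lift (pm_scale c f) = matrix_scale c (kron_lift f)"
  unfolding kron_lift_superset[OF finite_keys keys_pm_scale]
  by (simp add: kron_lift_def ms.scale_sum_right)

lemma kron_lift_diff: "kron_lift (f - g) = kron_lift f - kron_lift g"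
  using kron_lift_add[of "f - g" g] by (simp add: algebra_simps)

lemma kron_lift_sum: "kron_lift (\<Sum>i\<in>I. f i) = (\<Sum>i\<in>I. kron_lift (f i))"
  by (induction I rule: infinite_finite_induct) (auto simp: kron_lift_add)

abbreviation matrix_subalgebra :: "('k::field ^ 'n ^ 'n) set \<Rightarrow> ('k, 'k ^ 'n::finite ^ 'n) module" where
  "matrix_subalgebra V \<equiv> matrix_algebra\<lparr>carrier := V\<rparr>"

lemma kron_lift_free_mult:
  "kron_lift (free_mult (matrix_subalgebra V1) (matrix_subalgebra V2) f g) = kron_lift f ** kron_lift g"
proof -
  have "kron_lift (free_mult (matrix_subalgebra V1) (matrix_subalgebra V2) f g)
     = (\<Sum>p\<in>Poly_Mapping.keys f. \<Sum>q\<in>Poly_Mapping.keys g.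
         matrix_scale (Poly_Mapping.lookup f p * Poly_Mapping.lookup g q)
           (kron (fst p) (snd p) ** kron (fst q) (snd q)))"
    by (simp add: free_mult_def kron_lift_sum kron_mult)
  also have "\<dots> = kron_lift f ** kron_lift g"
    unfolding kron_lift_def sum_matrix_mult unfolding matrix_mult_sum_right
    by (simp only: matrix_scale_mult_left matrix_scale_mult_right ms.scale_scale mult.commute)
  finally show ?thesis .
qed

lemma pm_sum_single:
  "f = (\<Sum>p\<in>Poly_Mapping.keys f. pm_scale (Poly_Mapping.lookup f p) (Poly_Mapping.single p 1))"
proof (rule poly_mapping_eqI)
  fix k
  have "Poly_Mapping.lookup (\<Sum>p\<in>Poly_Mapping.keys f. pm_scale (Poly_Mapping.lookup f p) (Poly_Mapping.single p 1)) k
      = (\<Sum>p\<in>Poly_Mapping.keys f. if p = k then Poly_Mapping.lookup f p else 0)"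
    unfolding lookup_sum by (rule sum.cong) (simp_all add: lookup_single when_def)
  also have "\<dots> = Poly_Mapping.lookup f k"
    by (subst sum.delta) (simp_all add: in_keys_iff)
  finally show "Poly_Mapping.lookup f k = Poly_Mapping.lookup (\<Sum>p\<in>Poly_Mapping.keys f.
      pm_scale (Poly_Mapping.lookup f p) (Poly_Mapping.single p 1)) k" ..
qed

section \<open>The bilinear relations as the kernel of evaluation\<close>

context
  fixes V1 :: "('k::field ^ 'a::finite ^ 'a) set" and V2 :: "('k ^ 'b::finite ^ 'b) set"
  assumes V1: "ms.subspace V1" and V2: "ms.subspace V2"
begin

abbreviation "rel \<equiv> bilinear_relations (matrix_subalgebra V1) (matrix_subalgebra V2)"
abbreviation "ev x y \<equiv> Poly_Mapping.single (x, y) (1::'k)"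

definition formal_sums :: "(('k ^ 'a ^ 'a) \<times> ('k ^ 'b ^ 'b) \<Rightarrow>\<^sub>0 'k) set" where
  "formal_sums = {f. Poly_Mapping.keys f \<subseteq> V1 \<times> V2}"

lemma subspace_formal_sums: "pm.subspace formal_sums"
  unfolding formal_sums_def
proof (rule pm.subspaceI; unfold mem_Collect_eq)
  fix f g :: "('k ^ 'a ^ 'a) \<times> ('k ^ 'b ^ 'b) \<Rightarrow>\<^sub>0 'k"
  assume "Poly_Mapping.keys f \<subseteq> V1 \<times> V2" "Poly_Mapping.keys g \<subseteq> V1 \<times> V2"
  then show "Poly_Mapping.keys (f + g) \<subseteq> V1 \<times> V2"
    using Poly_Mapping.keys_add[of f g] by blast
next
  fix c and f :: "('k ^ 'a ^ 'a) \<times> ('k ^ 'b ^ 'b) \<Rightarrow>\<^sub>0 'k"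
  assume "Poly_Mapping.keys f \<subseteq> V1 \<times> V2"
  then show "Poly_Mapping.keys (pm_scale c f) \<subseteq> V1 \<times> V2"
    using keys_pm_scale[of c f] by blast
qed simp

lemma single_formal_sums: "x \<in> V1 \<Longrightarrow> y \<in> V2 \<Longrightarrow> Poly_Mapping.single (x, y) c \<in> formal_sums"
  by (simp add: formal_sums_def)

text \<open>Each generator evaluates to 0 because \<open>kron\<close> is bilinear, and lies in
  \<open>formal_sums\<close> because \<open>V1\<close> and \<open>V2\<close> are subspaces.\<close>

lemma bilinear_relations_subset_kernel: "rel \<subseteq> {f \<in> formal_sums. kron_lift f = 0}"
  unfolding bilinear_relations_def Let_def
proof (rule pm.span_minimal)
  show "pm.subspace {f \<in> formal_sums. kron_lift f = 0}"
    by (rule pm.subspaceI)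
      (simp_all add: kron_lift_add kron_lift_scale pm.subspace_add[OF subspace_formal_sums]
        pm.subspace_scale[OF subspace_formal_sums] pm.subspace_0[OF subspace_formal_sums])
qed (auto simp: kron_lift_diff kron_lift_scale kron_add_left kron_add_right kron_scale_left
    kron_scale_right intro!: pm.subspace_diff[OF subspace_formal_sums]
    pm.subspace_scale[OF subspace_formal_sums] single_formal_sums ms.subspace_add[OF V1]
    ms.subspace_add[OF V2] ms.subspace_scale[OF V1] ms.subspace_scale[OF V2])

lemma relI:
  shows "x \<in> V1 \<Longrightarrow> x' \<in> V1 \<Longrightarrow> y \<in> V2 \<Longrightarrow> ev (x + x') y - ev x y - ev x' y \<in> rel"
    and "x \<in> V1 \<Longrightarrow> y \<in> V2 \<Longrightarrow> y' \<in> V2 \<Longrightarrow> ev x (y + y') - ev x y - ev x y' \<in> rel"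
    and "x \<in> V1 \<Longrightarrow> y \<in> V2 \<Longrightarrow> ev (matrix_scale c x) y - pm_scale c (ev x y) \<in> rel"
    and "x \<in> V1 \<Longrightarrow> y \<in> V2 \<Longrightarrow> ev x (matrix_scale c y) - pm_scale c (ev x y) \<in> rel"
  unfolding bilinear_relations_def Let_def by (rule pm.span_base, simp, blast)+

lemma subspace_rel: "pm.subspace rel"
  unfolding bilinear_relations_def by (rule pm.subspace_span)

lemma rel_sum_left:
  assumes "finite B" "B \<subseteq> V1" "y \<in> V2"
  shows "ev (\<Sum>b\<in>B. matrix_scale (u b) b) y - (\<Sum>b\<in>B. pm_scale (u b) (ev b y)) \<in> rel"
  using assms
proof (induction B)
  case empty
  \<comment> \<open>The relation for the scalar 0 puts a pure tensor with zero factor into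
    \<open>rel\<close>.\<close>
  have "ev (matrix_scale 0 0) y - pm_scale 0 (ev 0 y) \<in> rel"
    by (rule relI) (use ms.subspace_0[OF V1] assms in auto)
  then show ?case by simp
next
  case (insert b B)
  let ?s = "\<Sum>b\<in>B. matrix_scale (u b) b" and ?b = "matrix_scale (u b) b"
  have b: "b \<in> V1" "?b \<in> V1" and s: "?s \<in> V1"
    using insert.prems by (auto intro!: ms.subspace_scale[OF V1] ms.subspace_sum[OF V1])
  \<comment> \<open>The intermediate terms \<open>ev ?b y\<close> and \<open>ev ?s y\<close>
    cancel.\<close>
  have "(ev (?b + ?s) y - ev ?b y - ev ?s y) + (ev ?b y - pm_scale (u b) (ev b y))
      + (ev ?s y - (\<Sum>b\<in>B. pm_scale (u b) (ev b y))) \<in> rel"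
    using insert b s by (intro pm.subspace_add[OF subspace_rel] relI) auto
  then show ?case
    using insert.hyps by (simp add: algebra_simps)
qed

lemma rel_sum_right:
  assumes "finite B" "B \<subseteq> V2" "x \<in> V1"
  shows "ev x (\<Sum>b\<in>B. matrix_scale (u b) b) - (\<Sum>b\<in>B. pm_scale (u b) (ev x b)) \<in> rel"
  using assms
proof (induction B)
  case empty
  have "ev x (matrix_scale 0 0) - pm_scale 0 (ev x 0) \<in> rel"
    by (rule relI) (use ms.subspace_0[OF V2] assms in auto)
  then show ?case by simp
next
  case (insert b B)
  let ?s = "\<Sum>b\<in>B. matrix_scale (u b) b" and ?b = "matrix_scale (u b) b"
  have b: "b \<in> V2" "?b \<in> V2" and s: "?s \<in> V2"
    using insert.prems by (auto intro!: ms.subspace_scale[OF V2] ms.subspace_sum[OF V2])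
  have "(ev x (?b + ?s) - ev x ?b - ev x ?s) + (ev x ?b - pm_scale (u b) (ev x b))
      + (ev x ?s - (\<Sum>b\<in>B. pm_scale (u b) (ev x b))) \<in> rel"
    using insert b s by (intro pm.subspace_add[OF subspace_rel] relI) auto
  then show ?case
    using insert.hyps by (simp add: algebra_simps)
qed

lemma rel_sum_sum:
  assumes B1: "finite B1" "B1 \<subseteq> V1" and B2: "finite B2" "B2 \<subseteq> V2"
  shows "ev (\<Sum>b\<in>B1. matrix_scale (u b) b) (\<Sum>c\<in>B2. matrix_scale (v c) c)
    - (\<Sum>b\<in>B1. \<Sum>c\<in>B2. pm_scale (u b * v c) (ev b c)) \<in> rel"
proof -
  let ?y = "\<Sum>c\<in>B2. matrix_scale (v c) c"
  have y: "?y \<in> V2"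
    using B2 by (auto intro!: ms.subspace_scale[OF V2] ms.subspace_sum[OF V2])
  have "(\<Sum>b\<in>B1. pm_scale (u b) (ev b ?y - (\<Sum>c\<in>B2. pm_scale (v c) (ev b c)))) \<in> rel"
    using assms by (intro pm.subspace_sum[OF subspace_rel] pm.subspace_scale[OF subspace_rel] rel_sum_right) auto
  from pm.subspace_add[OF subspace_rel rel_sum_left[OF B1 y, of u] this]
  show ?thesis
    by (simp add: pm.scale_right_diff_distrib pm.scale_sum_right sum_subtractf)
qed

text \<open>Modulo \<open>rel\<close>, each pair in \<open>f\<close> expands in pairs of basis
  elements of \<open>V1\<close> and \<open>V2\<close>. Evaluation turns the expansion of
  \<open>f\<close> into a relation among Kronecker products of basis elements, so its coefficients
  vanish.\<close>

lemma kernel_subset_bilinear_relations: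
  assumes f: "f \<in> formal_sums" "kron_lift f = 0"
  shows "f \<in> rel"
proof -
  obtain B1 where B1: "B1 \<subseteq> V1" "ms.independent B1" "V1 \<subseteq> ms.span B1"
    by (rule ms.maximal_independent_subset)
  obtain B2 where B2: "B2 \<subseteq> V2" "ms.independent B2" "V2 \<subseteq> ms.span B2"
    by (rule ms.maximal_independent_subset)
  have fin: "finite B1" "finite B2"
    by (rule finite_independent_matrices, fact)+
  define u where "u = (\<lambda>p :: ('k ^ 'a ^ 'a) \<times> ('k ^ 'b ^ 'b). ms.representation B1 (fst p))"
  define v where "v = (\<lambda>p :: ('k ^ 'a ^ 'a) \<times> ('k ^ 'b ^ 'b). ms.representation B2 (snd p))"
  \<comment> \<open>\<open>a b c\<close> is the total coefficient of \<open>ev b c\<close> once all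
    pairs in \<open>f\<close> are expanded.\<close>
  define a where "a = (\<lambda>b c. \<Sum>p\<in>Poly_Mapping.keys f. Poly_Mapping.lookup f p * (u p b * v p c))"
  let ?g = "\<lambda>p. \<Sum>b\<in>B1. \<Sum>c\<in>B2. pm_scale (u p b * v p c) (ev b c)"
  have p: "Poly_Mapping.single p 1 - ?g p \<in> rel" if "p \<in> Poly_Mapping.keys f" for p
  proof -
    have V: "fst p \<in> V1" "snd p \<in> V2"
      using that f(1) by (auto simp: formal_sums_def)
    have "(\<Sum>b\<in>B1. matrix_scale (u p b) b) = fst p" "(\<Sum>c\<in>B2. matrix_scale (v p c) c) = snd p"
      unfolding u_def v_def
      by (rule ms.sum_representation_eq; use B1 B2 fin V in blast)+
    then show ?thesis
      using rel_sum_sum[OF fin(1) B1(1) fin(2) B2(1), of "u p" "v p"] by simp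
  qed
  have "(\<Sum>p\<in>Poly_Mapping.keys f. pm_scale (Poly_Mapping.lookup f p) (Poly_Mapping.single p 1 - ?g p)) \<in> rel"
    by (intro pm.subspace_sum[OF subspace_rel] pm.subspace_scale[OF subspace_rel] p)
  also have "(\<Sum>p\<in>Poly_Mapping.keys f. pm_scale (Poly_Mapping.lookup f p) (Poly_Mapping.single p 1 - ?g p))
      = f - (\<Sum>p\<in>Poly_Mapping.keys f. pm_scale (Poly_Mapping.lookup f p) (?g p))"
    by (simp only: pm.scale_right_diff_distrib sum_subtractf pm_sum_single[symmetric])
  also have "(\<Sum>p\<in>Poly_Mapping.keys f. pm_scale (Poly_Mapping.lookup f p) (?g p))
      = (\<Sum>b\<in>B1. \<Sum>c\<in>B2. pm_scale (a b c) (ev b c))"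
    unfolding a_def pm.scale_sum_left pm.scale_sum_right pm.scale_scale
    by (subst sum.swap, rule sum.cong[OF refl], rule sum.swap)
  finally have rel: "f - (\<Sum>b\<in>B1. \<Sum>c\<in>B2. pm_scale (a b c) (ev b c)) \<in> rel" .
  then have "kron_lift (f - (\<Sum>b\<in>B1. \<Sum>c\<in>B2. pm_scale (a b c) (ev b c))) = 0"
    using bilinear_relations_subset_kernel by blast
  then have "(\<Sum>b\<in>B1. \<Sum>c\<in>B2. matrix_scale (a b c) (kron b c)) = 0"
    by (simp add: kron_lift_diff kron_lift_sum kron_lift_scale f(2))
  then have "a b c = 0" if "b \<in> B1" "c \<in> B2" for b c
    using kron_independent[OF B1(2) B2(2) _ that] by blast
  then have "(\<Sum>b\<in>B1. \<Sum>c\<in>B2. pm_scale (a b c) (ev b c)) = 0"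
    by simp
  with rel show ?thesis by simp
qed

lemma rel_eq_kernel: "rel = {f \<in> formal_sums. kron_lift f = 0}"
  using bilinear_relations_subset_kernel kernel_subset_bilinear_relations by blast

text \<open>Since \<open>rel\<close> is the kernel of evaluation on \<open>formal_sums\<close>, the
  elements of the tensor product are the nonempty fibers of \<open>kron_lift\<close> there.\<close>

lemma coset_rel:
  assumes f: "f \<in> formal_sums"
  shows "rel +>\<^bsub>free_algebra (matrix_subalgebra V1) (matrix_subalgebra V2)\<^esub> f
    = {g \<in> formal_sums. kron_lift g = kron_lift f}"
proof -
  have "rel +>\<^bsub>free_algebra (matrix_subalgebra V1) (matrix_subalgebra V2)\<^esub> f = (\<lambda>r. r + f) ` rel"
    by (auto simp: a_r_coset_def' free_algebra_def)
  also have "\<dots> = {g \<in> formal_sums. kron_lift g = kron_lift f}"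
  proof (intro subset_antisym subsetI)
    fix g assume "g \<in> (\<lambda>r. r + f) ` rel"
    then show "g \<in> {g \<in> formal_sums. kron_lift g = kron_lift f}"
      using f by (auto simp: rel_eq_kernel kron_lift_add pm.subspace_add[OF subspace_formal_sums])
  next
    fix g assume g: "g \<in> {g \<in> formal_sums. kron_lift g = kron_lift f}"
    then have "g - f \<in> rel"
      using f by (simp add: rel_eq_kernel kron_lift_diff pm.subspace_diff[OF subspace_formal_sums])
    then show "g \<in> (\<lambda>r. r + f) ` rel"
      by (rule rev_image_eqI) simp
  qed
  finally show ?thesis .
qed

section \<open>From matrices to the tensor product\<close>

text \<open>The inverse of evaluation: a matrix in the image goes to the coset of its preimages.
  Outside the image the value is the empty set.\<close>

definition fiber :: "'k ^ ('a \<times> 'b) ^ ('a \<times> 'b) \<Rightarrow> (('k ^ 'a ^ 'a) \<times> ('k ^ 'b ^ 'b) \<Rightarrow>\<^sub>0 'k) set" where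
  "fiber A = {f \<in> formal_sums. kron_lift f = A}"

lemma free_mult_formal_sums:
  assumes mult1: "\<And>x y. x \<in> V1 \<Longrightarrow> y \<in> V1 \<Longrightarrow> x ** y \<in> V1"
    and mult2: "\<And>x y. x \<in> V2 \<Longrightarrow> y \<in> V2 \<Longrightarrow> x ** y \<in> V2"
    and fg: "f \<in> formal_sums" "g \<in> formal_sums"
  shows "free_mult (matrix_subalgebra V1) (matrix_subalgebra V2) f g \<in> formal_sums"
  unfolding free_mult_def
proof (intro pm.subspace_sum[OF subspace_formal_sums])
  fix p q assume "p \<in> Poly_Mapping.keys f" "q \<in> Poly_Mapping.keys g"
  then have "p \<in> V1 \<times> V2" "q \<in> V1 \<times> V2"
    using fg unfolding formal_sums_def by blast+
  then show "Poly_Mapping.single (fst p \<otimes>\<^bsub>matrix_subalgebra V1\<^esub> fst q, snd p \<otimes>\<^bsub>matrix_subalgebra V2\<^esub> snd q)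
      (Poly_Mapping.lookup f p * Poly_Mapping.lookup g q) \<in> formal_sums"
    by (auto intro!: single_formal_sums mult1 mult2)
qed

lemma mult_kron_lift_formal_sums:
  assumes "\<And>x y. x \<in> V1 \<Longrightarrow> y \<in> V1 \<Longrightarrow> x ** y \<in> V1"
    and "\<And>x y. x \<in> V2 \<Longrightarrow> y \<in> V2 \<Longrightarrow> x ** y \<in> V2"
    and A: "A \<in> kron_lift ` formal_sums" and B: "B \<in> kron_lift ` formal_sums"
  shows "A ** B \<in> kron_lift ` formal_sums"
proof -
  obtain f g where f: "f \<in> formal_sums" "A = kron_lift f" and g: "g \<in> formal_sums" "B = kron_lift g"
    using A B by blast
  have "free_mult (matrix_subalgebra V1) (matrix_subalgebra V2) f g \<in> formal_sums"
    by (rule free_mult_formal_sums) (use assms f g in blast)+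
  then show ?thesis
    by (rule rev_image_eqI) (simp add: f g kron_lift_free_mult)
qed

text \<open>Evaluation is injective on the tensor product and respects the operations, so its
  inverse does the same on any part \<open>W\<close> of the image. Inclusion in the image makes
  every fiber over \<open>W\<close> nonempty, hence a coset.\<close>

lemma fiber_in_tensor_product:
  assumes mult1: "\<And>x y. x \<in> V1 \<Longrightarrow> y \<in> V1 \<Longrightarrow> x ** y \<in> V1"
    and mult2: "\<And>x y. x \<in> V2 \<Longrightarrow> y \<in> V2 \<Longrightarrow> x ** y \<in> V2"
    and one: "mat 1 \<in> V1" "mat 1 \<in> V2"
    and W: "W \<subseteq> kron_lift ` formal_sums"
  shows "fiber \<in> algebra_hom (matrix_subalgebra W) (tensor_product (matrix_subalgebra V1) (matrix_subalgebra V2))"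
    and "inj_on fiber W"
proof -
  let ?F = "free_algebra (matrix_subalgebra V1) (matrix_subalgebra V2)"
  let ?T = "tensor_product (matrix_subalgebra V1) (matrix_subalgebra V2)"
  have F: "carrier ?F = formal_sums" "\<one>\<^bsub>?F\<^esub> = ev (mat 1) (mat 1)"
    "f \<oplus>\<^bsub>?F\<^esub> g = f + g" "c \<odot>\<^bsub>?F\<^esub> f = pm_scale c f"
    "f \<otimes>\<^bsub>?F\<^esub> g = free_mult (matrix_subalgebra V1) (matrix_subalgebra V2) f g" for f g c
    by (simp_all add: free_algebra_def formal_sums_def)
  have T: "carrier ?T = a_rcosets\<^bsub>?F\<^esub> rel" "\<one>\<^bsub>?T\<^esub> = rel +>\<^bsub>?F\<^esub> ev (mat 1) (mat 1)"
    "U \<oplus>\<^bsub>?T\<^esub> U' = U <+>\<^bsub>?F\<^esub> U'" "U \<otimes>\<^bsub>?T\<^esub> U' = rcoset_mult ?F rel U U'"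
    "c \<odot>\<^bsub>?T\<^esub> U = (\<Union>f\<in>U. rel +>\<^bsub>?F\<^esub> pm_scale c f)" for U U' c
    by (simp_all add: tensor_product_def Let_def FactRing_def ring.defs module.defs F)
  have coset: "rel +>\<^bsub>?F\<^esub> f = fiber (kron_lift f)" if "f \<in> formal_sums" for f
    using coset_rel[OF that] by (simp only: fiber_def)
  have lift: "\<exists>f. f \<in> fiber A" if "A \<in> W" for A
    using that W by (auto simp: fiber_def)
  have mem: "f \<in> formal_sums" "kron_lift f = A" if "f \<in> fiber A" for f A
    using that by (simp_all add: fiber_def)
  note mult = free_mult_formal_sums[OF mult1 mult2]
  have "fiber \<in> ring_hom (matrix_subalgebra W) ?T"
  proof (rule ring_hom_memI)
    fix A assume "A \<in> carrier (matrix_subalgebra W)"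
    then obtain f where "f \<in> fiber A" using lift by auto
    then show "fiber A \<in> carrier ?T"
      using coset[of f] mem[of f A] by (auto simp: T A_RCOSETS_def' F)
  next
    fix A B assume "A \<in> carrier (matrix_subalgebra W)" "B \<in> carrier (matrix_subalgebra W)"
    then obtain f g where fg: "f \<in> fiber A" "g \<in> fiber B" using lift by force
    \<comment> \<open>\<open>rcoset_mult\<close> is a union over all pairs of representatives. Each
      pair contributes the same coset, and \<open>f\<close>, \<open>g\<close> show that there is
      such a pair.\<close>
    have "rel +>\<^bsub>?F\<^esub> (a \<otimes>\<^bsub>?F\<^esub> b) = fiber (A ** B)" if "a \<in> fiber A" "b \<in> fiber B" for a b
      using that mult[of a b] coset by (simp add: F mem kron_lift_free_mult)
    then have "rcoset_mult ?F rel (fiber A) (fiber B) = fiber (A ** B)"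
      unfolding rcoset_mult_def using fg by auto
    then show "fiber (A \<otimes>\<^bsub>matrix_subalgebra W\<^esub> B) = fiber A \<otimes>\<^bsub>?T\<^esub> fiber B"
      by (simp add: T)
    have "fiber A <+>\<^bsub>?F\<^esub> fiber B = fiber (A + B)"
    proof (intro subset_antisym subsetI)
      fix h assume "h \<in> fiber A <+>\<^bsub>?F\<^esub> fiber B"
      then obtain a b where "a \<in> fiber A" "b \<in> fiber B" "h = a + b"
        by (auto simp: set_add_def' F)
      then show "h \<in> fiber (A + B)"
        by (simp add: fiber_def kron_lift_add pm.subspace_add[OF subspace_formal_sums])
    next
      fix h assume "h \<in> fiber (A + B)"
      then have "h - f \<in> fiber B"
        using fg by (simp add: fiber_def kron_lift_diff pm.subspace_diff[OF subspace_formal_sums])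
      moreover have "h = f + (h - f)" by simp
      ultimately show "h \<in> fiber A <+>\<^bsub>?F\<^esub> fiber B"
        using fg(1) unfolding set_add_def' F by blast
    qed
    then show "fiber (A \<oplus>\<^bsub>matrix_subalgebra W\<^esub> B) = fiber A \<oplus>\<^bsub>?T\<^esub> fiber B"
      by (simp add: T)
  next
    show "fiber \<one>\<^bsub>matrix_subalgebra W\<^esub> = \<one>\<^bsub>?T\<^esub>"
      using coset[OF single_formal_sums[OF one]] by (simp add: T kron_one)
  qed
  moreover have "fiber (c \<odot>\<^bsub>matrix_subalgebra W\<^esub> A) = c \<odot>\<^bsub>?T\<^esub> fiber A"
    if "A \<in> carrier (matrix_subalgebra W)" for c A
  proof -
    obtain f where f: "f \<in> fiber A" using lift \<open>A \<in> _\<close> by auto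
    have "rel +>\<^bsub>?F\<^esub> pm_scale c a = fiber (matrix_scale c A)" if "a \<in> fiber A" for a
      using that coset[of "pm_scale c a"] pm.subspace_scale[OF subspace_formal_sums]
      by (simp add: mem kron_lift_scale)
    then show ?thesis
      using f by (auto simp: T)
  qed
  ultimately show "fiber \<in> algebra_hom (matrix_subalgebra W) ?T"
    unfolding algebra_hom_def by blast
  show "inj_on fiber W"
  proof (rule inj_onI)
    fix A B assume "A \<in> W" "fiber A = fiber B"
    \<comment> \<open>A common element of the two fibers evaluates both to \<open>A\<close> and to
      \<open>B\<close>.\<close>
    then obtain f where "f \<in> fiber A" "f \<in> fiber B" using lift by metis
    then show "A = B" using mem(2) by metis
  qed
qed

lemma subspace_kron_lift_formal_sums: "ms.subspace (kron_lift ` formal_sums)"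
proof (rule ms.subspaceI)
  show "0 \<in> kron_lift ` formal_sums"
    using pm.subspace_0[OF subspace_formal_sums] by (rule rev_image_eqI) simp
next
  fix A B assume "A \<in> kron_lift ` formal_sums" "B \<in> kron_lift ` formal_sums"
  then show "A + B \<in> kron_lift ` formal_sums"
    using pm.subspace_add[OF subspace_formal_sums] by (auto simp flip: kron_lift_add)
next
  fix c A assume "A \<in> kron_lift ` formal_sums"
  then show "matrix_scale c A \<in> kron_lift ` formal_sums"
    using pm.subspace_scale[OF subspace_formal_sums] by (auto simp flip: kron_lift_scale)
qed

lemma kron_in_kron_lift_formal_sums:
  assumes "x \<in> V1" "y \<in> V2"
  shows "kron x y \<in> kron_lift ` formal_sums"
  by (rule rev_image_eqI[OF single_formal_sums[OF assms, of 1]]) simp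

end

lemma subspace_range_matrix_poly: "ms.subspace (range (\<lambda>p. matrix_poly p A))"
proof (rule ms.subspaceI)
  show "0 \<in> range (\<lambda>p. matrix_poly p A)"
    by (rule range_eqI[of _ _ 0]) simp
next
  fix x y assume "x \<in> range (\<lambda>p. matrix_poly p A)" "y \<in> range (\<lambda>p. matrix_poly p A)"
  then obtain p q where "x = matrix_poly p A" "y = matrix_poly q A" by blast
  then show "x + y \<in> range (\<lambda>p. matrix_poly p A)"
    by (intro range_eqI[of _ _ "p + q"]) (simp add: matrix_poly_add)
next
  fix c x assume "x \<in> range (\<lambda>p. matrix_poly p A)"
  then obtain p where "x = matrix_poly p A" by blast
  then show "matrix_scale c x \<in> range (\<lambda>p. matrix_poly p A)"
    by (intro range_eqI[of _ _ "smult c p"]) (simp add: matrix_poly_smult)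
qed


section \<open>Product graphs\<close>

text \<open>Steps in \<open>S1\<close> keep the second coordinate, steps in \<open>S2\<close> the
  first. As 0 is not in \<open>S1\<close>, no step is of both kinds, so the indicator of the union
  is a sum of two indicators.\<close>

lemma adjacency_matrix_Cay_product:
  fixes S1 :: "'g::{finite, ab_group_add} set" and S2 :: "'h::{finite, ab_group_add} set"
  assumes S1: "0 \<notin> S1" "uminus ` S1 = S1" and S2: "uminus ` S2 = S2"
  shows "adjacency_matrix TYPE('k::field) (Cay (S1 \<times> {0} \<union> {0} \<times> S2))
    = kron (adjacency_matrix TYPE('k) (Cay S1)) (mat 1) + kron (mat 1) (adjacency_matrix TYPE('k) (Cay S2))"
proof -
  have "(if (h, h') - (g, g') \<in> S1 \<times> {0} \<union> {0} \<times> S2 then 1 else 0)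
      = (if h - g \<in> S1 then 1 else 0) * (if g' = h' then 1 else 0)
        + (if g = h then 1 else 0) * (if h' - g' \<in> S2 then 1 else (0::'k))" for g g' h h'
    using S1(1) by auto
  then have *: "adjacency_matrix TYPE('k) (Cay (S1 \<times> {0} \<union> {0} \<times> S2)) $ (g, g') $ (h, h')
      = (kron (adjacency_matrix TYPE('k) (Cay S1)) (mat 1)
        + kron (mat 1) (adjacency_matrix TYPE('k) (Cay S2))) $ (g, g') $ (h, h')" for g g' h h'
    by (simp only: vector_add_component kron_nth mat_def vec_lambda_beta fst_conv snd_conv
        adjacency_matrix_Cay[OF S1(2)] adjacency_matrix_Cay[OF S2]
        adjacency_matrix_Cay[OF uminus_image_product_connection_set[OF S1(2) S2]])
  show ?thesis
    unfolding vec_eq_iff split_paired_All by (intro allI *)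
qed

theorem proposition10p2:
  fixes S1 :: "'g1::{finite, ab_group_add} set"
    and S2 :: "'g2::{finite, ab_group_add} set"
    and S :: "('g1 \<times> 'g2) set"
  assumes "0 \<notin> S1" and "uminus ` S1 = S1"
    and "0 \<notin> S2" and "uminus ` S2 = S2"
    and "S = (S1 \<times> {0}) \<union> ({0} \<times> S2)"
    and "\<not> CHAR('k::field) dvd CARD('g1 \<times> 'g2)"
  shows "(\<exists>\<iota> \<in> algebra_hom (spectral_algebra TYPE('k) (Cay S))
              (tensor_product (spectral_algebra TYPE('k) (Cay S1)) (spectral_algebra TYPE('k) (Cay S2))).
            inj_on \<iota> (carrier (spectral_algebra TYPE('k) (Cay S))))
       \<and> spectral_dim TYPE('k) (Cay S) \<le> spectral_dim TYPE('k) (Cay S1) * spectral_dim TYPE('k) (Cay S2)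
       \<and> (spectral_dim TYPE('k) (Cay S) = spectral_dim TYPE('k) (Cay S1) * spectral_dim TYPE('k) (Cay S2)
            \<longleftrightarrow> inj_on (\<lambda>(l1, l2). l1 + l2)
                  (eigenvalues (map_matrix to_ac (adjacency_matrix TYPE('k) (Cay S1)))
                   \<times> eigenvalues (map_matrix to_ac (adjacency_matrix TYPE('k) (Cay S2)))))"
proof -
  define A1 where "A1 = adjacency_matrix TYPE('k) (Cay S1)"
  define A2 where "A2 = adjacency_matrix TYPE('k) (Cay S2)"
  define A where "A = adjacency_matrix TYPE('k) (Cay S)"
  define V1 where "V1 = range (\<lambda>p. matrix_poly p A1)"
  define V2 where "V2 = range (\<lambda>p. matrix_poly p A2)"
  define W where "W = range (\<lambda>p. matrix_poly p A)"
  have alg: "spectral_algebra TYPE('k) (Cay S1) = matrix_subalgebra V1"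
    "spectral_algebra TYPE('k) (Cay S2) = matrix_subalgebra V2"
    "spectral_algebra TYPE('k) (Cay S) = matrix_subalgebra W"
    by (simp_all add: spectral_algebra_def V1_def V2_def W_def A1_def A2_def A_def)
  have sub: "ms.subspace V1" "ms.subspace V2"
    unfolding V1_def V2_def by (rule subspace_range_matrix_poly)+
  have mult: "x ** y \<in> V1" if "x \<in> V1" "y \<in> V1" for x y
    using that unfolding V1_def by (elim rangeE) (simp add: matrix_poly_mult[symmetric])
  have mult': "x ** y \<in> V2" if "x \<in> V2" "y \<in> V2" for x y
    using that unfolding V2_def by (elim rangeE) (simp add: matrix_poly_mult[symmetric])
  have one: "mat 1 \<in> V1" "mat 1 \<in> V2"
    unfolding V1_def V2_def by (rule range_eqI[of _ _ 1], simp)+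
  have gen: "A1 \<in> V1" "A2 \<in> V2"
    unfolding V1_def V2_def by (rule range_eqI, rule matrix_poly_X[symmetric])+
  \<comment> \<open>\<open>?I\<close> is the matrix image of the tensor product of the two spectral
    algebras. It is closed under the algebra operations, so it contains \<open>W\<close> once it
    contains \<open>A\<close>.\<close>
  let ?I = "kron_lift ` formal_sums V1 V2"
  have I_one: "mat 1 \<in> ?I"
    using kron_in_kron_lift_formal_sums[OF sub one] by (simp only: kron_one)
  have I_add: "x + y \<in> ?I" if "x \<in> ?I" "y \<in> ?I" for x y
    using ms.subspace_add[OF subspace_kron_lift_formal_sums[OF sub]] that .
  have "A = kron A1 (mat 1) + kron (mat 1) A2"
    unfolding A_def A1_def A2_def \<open>S = _\<close> by (rule adjacency_matrix_Cay_product) fact+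
  then have I_A: "A \<in> ?I"
    by (simp only: I_add kron_in_kron_lift_formal_sums[OF sub] gen one)
  have "matrix_poly p A \<in> ?I" for p
  proof (induction p)
    case 0
    show ?case
      using ms.subspace_0[OF subspace_kron_lift_formal_sums[OF sub]] by simp
  next
    case (pCons a p)
    have "A ** matrix_poly p A \<in> ?I"
      by (rule mult_kron_lift_formal_sums[OF sub mult mult' I_A pCons.IH])
    then show ?case
      unfolding matrix_poly_pCons
      by (intro I_add ms.subspace_scale[OF subspace_kron_lift_formal_sums[OF sub]] I_one)
  qed
  then have "W \<subseteq> ?I"
    unfolding W_def by blast
  note hom = fiber_in_tensor_product[OF sub mult mult' one this]
  have embedding: "\<exists>\<iota> \<in> algebra_hom (matrix_subalgebra W) (tensor_product (matrix_subalgebra V1) (matrix_subalgebra V2)).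
      inj_on \<iota> (carrier (matrix_subalgebra W))"
  proof
    show "inj_on (fiber V1 V2) (carrier (matrix_subalgebra W))"
      using hom(2) by simp
  qed (rule hom(1))

  have char: "of_nat CARD('g1 \<times> 'g2) \<noteq> (0::'k)"
    using assms(6) by (simp only: of_nat_eq_0_iff_char_dvd not_False_eq_True)
  then have char12: "of_nat CARD('g1) \<noteq> (0::'k)" "of_nat CARD('g2) \<noteq> (0::'k)"
    by auto
  have ac: "of_nat n \<noteq> (0::'k alg_closure)" if "of_nat n \<noteq> (0::'k)" for n
    using that by (metis to_ac_eq_0_iff to_ac_of_nat)
  have S: "uminus ` S = S"
    unfolding assms(5) by (rule uminus_image_product_connection_set) fact+
  let ?E = "\<lambda>A. eigenvalues (map_matrix to_ac A)"
  have dims: "spectral_dim TYPE('k) (Cay S) = card (?E A)"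
    "spectral_dim TYPE('k) (Cay S1) = card (?E A1)" "spectral_dim TYPE('k) (Cay S2) = card (?E A2)"
    unfolding A_def A1_def A2_def
    by (rule spectral_dim_eq_card_eigenvalues[OF S char],
        rule spectral_dim_eq_card_eigenvalues[OF assms(2) char12(1)],
        rule spectral_dim_eq_card_eigenvalues[OF assms(4) char12(2)])
  \<comment> \<open>Stated for an arbitrary group, for use with both factors and the product. A
    matrix of zeros and ones keeps its shape over the closure, where the character sums
    live.\<close>
  have ev: "?E (adjacency_matrix TYPE('k) (Cay T)) = (\<lambda>c. \<Sum>s\<in>T. c s) ` characters
      \<and> finite (?E (adjacency_matrix TYPE('k) (Cay T)))"
    if T: "uminus ` T = T" and "of_nat CARD('g) \<noteq> (0::'k)" for T :: "'g::{finite, ab_group_add} set"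
  proof -
    have "map_matrix to_ac (adjacency_matrix TYPE('k) (Cay T)) = adjacency_matrix TYPE('k alg_closure) (Cay T)"
      by (simp add: vec_eq_iff adjacency_matrix_Cay[OF T])
    then show ?thesis
      using eigenvalues_Cay(1,2)[OF T ac] that(2) by simp
  qed
  have fin: "finite (?E A1 \<times> ?E A2)"
    unfolding A1_def A2_def
    by (intro finite_cartesian_product conjunct2[OF ev[OF assms(2) char12(1)]]
        conjunct2[OF ev[OF assms(4) char12(2)]])
  have "?E A = (\<lambda>(l1, l2). l1 + l2) ` (?E A1 \<times> ?E A2)"
    unfolding A_def A1_def A2_def
    using ev[OF S char] ev[OF assms(2) char12(1)] ev[OF assms(4) char12(2)]
      character_sums_product[OF assms(1), of S2]
    by (simp only: assms(5))
  \<comment> \<open>The image of a finite set has at most as many elements as the set, with equality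
    exactly for an injective map; here the map is addition on pairs of eigenvalues.\<close>
  then have card: "card (?E A) \<le> card (?E A1) * card (?E A2)"
    "card (?E A) = card (?E A1) * card (?E A2) \<longleftrightarrow> inj_on (\<lambda>(l1, l2). l1 + l2) (?E A1 \<times> ?E A2)"
    using card_image_le[OF fin, of "\<lambda>(l1, l2). l1 + l2"]
      inj_on_iff_eq_card[OF fin, of "\<lambda>(l1, l2). l1 + l2"]
    by (simp_all add: card_cartesian_product)
  show ?thesis
    unfolding alg dims A1_def[symmetric] A2_def[symmetric]
    using embedding card by (intro conjI)
qed

end
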